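(* Let $\iota:X\to X^R\subset\{0,1\}^{\mathcal H(X)}$ be the Roller compactification of a finite-rank median algebra $X$. Assume that an abstract discrete group $G$ acts on $X$ by median automorphisms. Then the induced compact dynamical system $(G,X^R)$ is Rosenthal representable.
   Context: A median algebra is a set $X$ with a ternary operation $m:X^3\to X$ such that $m$ is invariant under permutations of its arguments, $m(a,b,b)=b$, and $m(m(a,x,b),x,c)=m(a,x,m(b,x,c))$ for all $a,b,c,x\in X$. A median automorphism is a bijection $g:X\to X$ with $g(m(x,y,z))=m(gx,gy,gz)$. The rank of $X$ is the supremum of the $n\in\mathbb N$ such that $\{0,1\}^n$ (with coordinatewise median) embeds in $X$ as a median subalgebra. For $x,y\in X$ put $[x,y]=\{z: m(x,y,z)=z\}$; $C\subseteq X$ is convex if $[x,y]\subseteq C$ for all $x,y\in C$. A halfspace is a nonempty convex subset of $X$ whose complement is nonempty and convex; $\mathcal H(X)$ is the set of all halfspaces. Roller compactification: $\iota:X\to\{0,1\}^{\mathcal H(X)}$, $\iota(x)=(\chi_H(x))_{H\in\mathcal H(X)}$, where $\chi_H$ is the characteristic function of $H$, and $X^R$ is the closure of $\iota(X)$ in the product topology. If $G$ acts on $X$ by median automorphisms then $gH\in\mathcal H(X)$ for all $g\in G$, $H\in\mathcal H(X)$, and the induced action on $X^R$ is $(g\xi)(H)=\xi(g^{-1}H)$; it is by homeomorphisms and $\iota$ is $G$-equivariant. A Banach space $V$ is Rosenthal if it contains no isomorphic copy of $\ell_1$. $\operatorname{Iso}(V)$ is the group of all linear onto isometries of $V$ with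 the strong operator topology. A $G$-space $K$ is Rosenthal representable if there are a Rosenthal Banach space $V$, a continuous homomorphism $h:G\to\operatorname{Iso}(V)$ and a $G$-equivariant topological embedding of $K$ into the dual unit ball $B_{V^*}$ with the weak-star topology, where $G$ acts by $(g\varphi)(v)=\varphi(h(g)^{-1}v)$. Here $G$ carries the discrete topology. *)

theory Defs
  imports
    "HOL-Analysis.Analysis"
    "HOL-Algebra.Group_Action"
    "HOL-Library.Function_Algebras"
    "HOL-Library.Extended_Nat"
begin

section \<open>Median algebras\<close>

locale median_algebra =
  fixes X :: "'a set" and m :: "'a \<Rightarrow> 'a \<Rightarrow> 'a \<Rightarrow> 'a"
  assumes closed: "\<lbrakk>a \<in> X; b \<in> X; c \<in> X\<rbrakk> \<Longrightarrow> m a b c \<in> X"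
    \<comment> \<open>the two transpositions generate all permutations of the arguments\<close>
    and swap12: "\<lbrakk>a \<in> X; b \<in> X; c \<in> X\<rbrakk> \<Longrightarrow> m b a c = m a b c"
    and swap23: "\<lbrakk>a \<in> X; b \<in> X; c \<in> X\<rbrakk> \<Longrightarrow> m a c b = m a b c"
    and majority: "\<lbrakk>a \<in> X; b \<in> X\<rbrakk> \<Longrightarrow> m a b b = b"
    and assoc: "\<lbrakk>a \<in> X; b \<in> X; c \<in> X; x \<in> X\<rbrakk> \<Longrightarrow> m (m a x b) x c = m a x (m b x c)"

definition median_hom ::
  "'a set \<Rightarrow> ('a \<Rightarrow> 'a \<Rightarrow> 'a \<Rightarrow> 'a) \<Rightarrow> 'b set \<Rightarrow> ('b \<Rightarrow> 'b \<Rightarrow> 'b \<Rightarrow> 'b) \<Rightarrow> ('a \<Rightarrow> 'b) \<Rightarrow> bool"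
  where "median_hom X m Y n f \<longleftrightarrow>
    f \<in> X \<rightarrow> Y \<and> (\<forall>x\<in>X. \<forall>y\<in>X. \<forall>z\<in>X. f (m x y z) = n (f x) (f y) (f z))"

definition median_automorphism :: "'a set \<Rightarrow> ('a \<Rightarrow> 'a \<Rightarrow> 'a \<Rightarrow> 'a) \<Rightarrow> ('a \<Rightarrow> 'a) \<Rightarrow> bool"
  where "median_automorphism X m f \<longleftrightarrow> bij_betw f X X \<and> median_hom X m X m f"

definition cube :: "nat \<Rightarrow> (nat \<Rightarrow> bool) set"
  where "cube n = {..<n} \<rightarrow>\<^sub>E UNIV"

definition cube_median ::
  "nat \<Rightarrow> (nat \<Rightarrow> bool) \<Rightarrow> (nat \<Rightarrow> bool) \<Rightarrow> (nat \<Rightarrow> bool) \<Rightarrow> nat \<Rightarrow> bool"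
  where "cube_median n x y z = (\<lambda>i\<in>{..<n}. x i \<and> y i \<or> y i \<and> z i \<or> x i \<and> z i)"

definition median_rank :: "'a set \<Rightarrow> ('a \<Rightarrow> 'a \<Rightarrow> 'a \<Rightarrow> 'a) \<Rightarrow> enat"
  where "median_rank X m =
    Sup {enat n | n. \<exists>f. inj_on f (cube n) \<and> median_hom (cube n) (cube_median n) X m f}"

definition median_interval :: "'a set \<Rightarrow> ('a \<Rightarrow> 'a \<Rightarrow> 'a \<Rightarrow> 'a) \<Rightarrow> 'a \<Rightarrow> 'a \<Rightarrow> 'a set"
  where "median_interval X m x y = {z \<in> X. m x y z = z}"

definition median_convex :: "'a set \<Rightarrow> ('a \<Rightarrow> 'a \<Rightarrow> 'a \<Rightarrow> 'a) \<Rightarrow> 'a set \<Rightarrow> bool"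
  where "median_convex X m C \<longleftrightarrow> C \<subseteq> X \<and> (\<forall>x\<in>C. \<forall>y\<in>C. median_interval X m x y \<subseteq> C)"

definition halfspaces :: "'a set \<Rightarrow> ('a \<Rightarrow> 'a \<Rightarrow> 'a \<Rightarrow> 'a) \<Rightarrow> 'a set set"
  where "halfspaces X m =
    {H. H \<noteq> {} \<and> median_convex X m H \<and> X - H \<noteq> {} \<and> median_convex X m (X - H)}"

section \<open>Roller compactification\<close>

definition halfspace_cube :: "'a set \<Rightarrow> ('a \<Rightarrow> 'a \<Rightarrow> 'a \<Rightarrow> 'a) \<Rightarrow> ('a set \<Rightarrow> bool) topology"
  where "halfspace_cube X m =
    product_topology (\<lambda>_. discrete_topology (UNIV :: bool set)) (halfspaces X m)"

definition roller_map :: "'a set \<Rightarrow> ('a \<Rightarrow> 'a \<Rightarrow> 'a \<Rightarrow> 'a) \<Rightarrow> 'a \<Rightarrow> 'a set \<Rightarrow> bool"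
  where "roller_map X m x = (\<lambda>H\<in>halfspaces X m. x \<in> H)"

definition roller :: "'a set \<Rightarrow> ('a \<Rightarrow> 'a \<Rightarrow> 'a \<Rightarrow> 'a) \<Rightarrow> ('a set \<Rightarrow> bool) topology"
  where "roller X m =
    subtopology (halfspace_cube X m) (halfspace_cube X m closure_of (roller_map X m ` X))"

definition roller_action ::
  "('g, 'r) monoid_scheme \<Rightarrow> 'a set \<Rightarrow> ('a \<Rightarrow> 'a \<Rightarrow> 'a \<Rightarrow> 'a) \<Rightarrow> ('g \<Rightarrow> 'a \<Rightarrow> 'a) \<Rightarrow>
    'g \<Rightarrow> ('a set \<Rightarrow> bool) \<Rightarrow> 'a set \<Rightarrow> bool"
  where "roller_action G X m act g \<xi> = (\<lambda>H\<in>halfspaces X m. \<xi> (act (inv\<^bsub>G\<^esub> g) ` H))"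

section \<open>Normed spaces given by a carrier and a norm\<close>

text \<open>
  A space \<open>(V, N)\<close> is a linear subspace \<open>V\<close> of an ambient real vector space together with a norm
  \<open>N\<close> on \<open>V\<close>; the values of \<open>N\<close> outside \<open>V\<close> are irrelevant.  Working with carriers
  rather than with the class \<open>banach\<close> allows quantification over Banach spaces.
\<close>

definition normed_space_on :: "'v::real_vector set \<Rightarrow> ('v \<Rightarrow> real) \<Rightarrow> bool"
  where "normed_space_on V N \<longleftrightarrow> subspace V \<and>
    (\<forall>v\<in>V. 0 \<le> N v \<and> (N v = 0 \<longleftrightarrow> v = 0)) \<and>
    (\<forall>v\<in>V. \<forall>w\<in>V. N (v + w) \<le> N v + N w) \<and>
    (\<forall>c. \<forall>v\<in>V. N (c *\<^sub>R v) = \<bar>c\<bar> * N v)"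

text \<open>The cut-off is needed because \<open>Metric_space\<close> demands a nonnegative symmetric
  function on the whole type.\<close>

definition norm_dist :: "'v::real_vector set \<Rightarrow> ('v \<Rightarrow> real) \<Rightarrow> 'v \<Rightarrow> 'v \<Rightarrow> real"
  where "norm_dist V N x y = (if x \<in> V \<and> y \<in> V then N (x - y) else 0)"

definition norm_topology :: "'v::real_vector set \<Rightarrow> ('v \<Rightarrow> real) \<Rightarrow> 'v topology"
  where "norm_topology V N = Metric_space.mtopology V (norm_dist V N)"

lemma Metric_space_norm_dist:
  assumes "normed_space_on V N"
  shows "Metric_space V (norm_dist V N)"
proof -
  have sub: "subspace V"
    and nonneg: "\<And>v. v \<in> V \<Longrightarrow> 0 \<le> N v"
    and zero: "\<And>v. v \<in> V \<Longrightarrow> N v = 0 \<longleftrightarrow> v = 0"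
    and triangle: "\<And>v w. v \<in> V \<Longrightarrow> w \<in> V \<Longrightarrow> N (v + w) \<le> N v + N w"
    and scale: "\<And>c v. v \<in> V \<Longrightarrow> N (c *\<^sub>R v) = \<bar>c\<bar> * N v"
    using assms unfolding normed_space_on_def by simp_all
  have diff: "x - y \<in> V" if "x \<in> V" "y \<in> V" for x y
    using sub that by (rule subspace_diff)
  have sym: "N (x - y) = N (y - x)" if "x \<in> V" "y \<in> V" for x y
    using scale[OF diff[OF that(2,1)], of "-1"] by simp
  have tri: "N (x - z) \<le> N (x - y) + N (y - z)" if "x \<in> V" "y \<in> V" "z \<in> V" for x y z
    using triangle[OF diff[OF that(1,2)] diff[OF that(2,3)]] by simp
  show ?thesis
  proof (rule Metric_space.intro)
    show "0 \<le> norm_dist V N x y" for x y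
      by (simp add: norm_dist_def nonneg diff)
    show "norm_dist V N x y = norm_dist V N y x" for x y
      by (simp add: norm_dist_def sym[of x y])
    show "norm_dist V N x y = 0 \<longleftrightarrow> x = y" if "x \<in> V" "y \<in> V" for x y
      using that by (simp add: norm_dist_def zero diff)
    show "norm_dist V N x z \<le> norm_dist V N x y + norm_dist V N y z"
      if "x \<in> V" "y \<in> V" "z \<in> V" for x y z
      using that tri[OF that] by (simp add: norm_dist_def)
  qed
qed

definition banach_space_on :: "'v::real_vector set \<Rightarrow> ('v \<Rightarrow> real) \<Rightarrow> bool"
  where "banach_space_on V N \<longleftrightarrow>
    normed_space_on V N \<and> Metric_space.mcomplete V (norm_dist V N)"

definition linear_map_on :: "'v::real_vector set \<Rightarrow> ('v \<Rightarrow> 'w::real_vector) \<Rightarrow> bool"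
  where "linear_map_on V T \<longleftrightarrow>
    (\<forall>v\<in>V. \<forall>w\<in>V. T (v + w) = T v + T w) \<and> (\<forall>c. \<forall>v\<in>V. T (c *\<^sub>R v) = c *\<^sub>R T v)"

definition isomorphic_embedding ::
  "'v::real_vector set \<Rightarrow> ('v \<Rightarrow> real) \<Rightarrow> 'w::real_vector set \<Rightarrow> ('w \<Rightarrow> real) \<Rightarrow> ('v \<Rightarrow> 'w) \<Rightarrow> bool"
  where "isomorphic_embedding V N W M T \<longleftrightarrow>
    T \<in> V \<rightarrow> W \<and> linear_map_on V T \<and>
    (\<exists>c C. 0 < c \<and> (\<forall>v\<in>V. c * N v \<le> M (T v) \<and> M (T v) \<le> C * N v))"

subsection \<open>The pointwise real vector space of functions\<close>

instantiation "fun" :: (type, real_vector) real_vector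
begin

definition scaleR_fun :: "real \<Rightarrow> ('a \<Rightarrow> 'b) \<Rightarrow> 'a \<Rightarrow> 'b"
  where "scaleR_fun c f = (\<lambda>x. c *\<^sub>R f x)"

instance
proof
  fix a b :: real and f g :: "'a \<Rightarrow> 'b"
  show "a *\<^sub>R (f + g) = a *\<^sub>R f + a *\<^sub>R g"
    by (rule ext) (simp only: scaleR_fun_def plus_fun_apply scaleR_add_right)
  show "(a + b) *\<^sub>R f = a *\<^sub>R f + b *\<^sub>R f"
    by (rule ext) (simp only: scaleR_fun_def plus_fun_apply scaleR_add_left)
  show "a *\<^sub>R b *\<^sub>R f = (a * b) *\<^sub>R f"
    by (rule ext) (simp only: scaleR_fun_def scaleR_scaleR)
  show "1 *\<^sub>R f = f"
    by (rule ext) (simp only: scaleR_fun_def scaleR_one)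
qed

end

subsection \<open>Rosenthal spaces\<close>

definition ell1 :: "(nat \<Rightarrow> real) set"
  where "ell1 = {a. summable (\<lambda>n. \<bar>a n\<bar>)}"

definition ell1_norm :: "(nat \<Rightarrow> real) \<Rightarrow> real"
  where "ell1_norm a = (\<Sum>n. \<bar>a n\<bar>)"

definition rosenthal_space_on :: "'v::real_vector set \<Rightarrow> ('v \<Rightarrow> real) \<Rightarrow> bool"
  where "rosenthal_space_on V N \<longleftrightarrow>
    banach_space_on V N \<and> \<not> (\<exists>T. isomorphic_embedding ell1 ell1_norm V N T)"

subsection \<open>Isometry group and dual ball\<close>

definition iso_group :: "'v::real_vector set \<Rightarrow> ('v \<Rightarrow> real) \<Rightarrow> ('v \<Rightarrow> 'v) monoid"
  where "iso_group V N =
    BijGroup V \<lparr>carrier := {T \<in> Bij V. linear_map_on V T \<and> (\<forall>v\<in>V. N (T v) = N v)}\<rparr>"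

definition strong_operator_topology :: "'v::real_vector set \<Rightarrow> ('v \<Rightarrow> real) \<Rightarrow> ('v \<Rightarrow> 'v) topology"
  where "strong_operator_topology V N =
    subtopology (product_topology (\<lambda>_. norm_topology V N) V) (carrier (iso_group V N))"

definition dual_space :: "'v::real_vector set \<Rightarrow> ('v \<Rightarrow> real) \<Rightarrow> ('v \<Rightarrow> real) set"
  where "dual_space V N =
    {\<phi> \<in> extensional V. linear_map_on V \<phi> \<and> (\<exists>B. \<forall>v\<in>V. \<bar>\<phi> v\<bar> \<le> B * N v)}"

definition dual_norm :: "'v::real_vector set \<Rightarrow> ('v \<Rightarrow> real) \<Rightarrow> ('v \<Rightarrow> real) \<Rightarrow> real"
  where "dual_norm V N \<phi> = (SUP v\<in>{v \<in> V. N v \<le> 1}. \<bar>\<phi> v\<bar>)"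

definition dual_ball :: "'v::real_vector set \<Rightarrow> ('v \<Rightarrow> real) \<Rightarrow> ('v \<Rightarrow> real) set"
  where "dual_ball V N = {\<phi> \<in> dual_space V N. dual_norm V N \<phi> \<le> 1}"

definition weak_star_ball :: "'v::real_vector set \<Rightarrow> ('v \<Rightarrow> real) \<Rightarrow> ('v \<Rightarrow> real) topology"
  where "weak_star_ball V N =
    subtopology (product_topology (\<lambda>_. euclideanreal) V) (dual_ball V N)"

definition dual_action ::
  "'v::real_vector set \<Rightarrow> ('v \<Rightarrow> real) \<Rightarrow> ('g \<Rightarrow> 'v \<Rightarrow> 'v) \<Rightarrow> 'g \<Rightarrow> ('v \<Rightarrow> real) \<Rightarrow> 'v \<Rightarrow> real"
  where "dual_action V N h g \<phi> = (\<lambda>v\<in>V. \<phi> ((inv\<^bsub>iso_group V N\<^esub> (h g)) v))"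

section \<open>Rosenthal representability\<close>

definition rosenthal_representation ::
  "('g, 'r) monoid_scheme \<Rightarrow> 'g topology \<Rightarrow> 'k topology \<Rightarrow> ('g \<Rightarrow> 'k \<Rightarrow> 'k) \<Rightarrow>
    'v::real_vector set \<Rightarrow> ('v \<Rightarrow> real) \<Rightarrow> ('g \<Rightarrow> 'v \<Rightarrow> 'v) \<Rightarrow> ('k \<Rightarrow> 'v \<Rightarrow> real) \<Rightarrow> bool"
  where "rosenthal_representation G TG K act V N h \<alpha> \<longleftrightarrow>
    rosenthal_space_on V N \<and>
    h \<in> hom G (iso_group V N) \<and>
    continuous_map TG (strong_operator_topology V N) h \<and>
    embedding_map K (weak_star_ball V N) \<alpha> \<and>
    (\<forall>g\<in>carrier G. \<forall>k\<in>topspace K. \<alpha> (act g k) = dual_action V N h g (\<alpha> k))"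

text \<open>
  HOL cannot quantify over types inside a formula, so \<open>V\<close> ranges over the Banach spaces whose
  vectors are real functions on the type of points of \<open>K\<close> (linear operations are pointwise, the
  norm is arbitrary).  This loses no generality.  Let \<open>(V, h, \<alpha>)\<close> represent the \<open>G\<close>-space
  \<open>K\<close> on any Rosenthal space, and let \<open>A\<close> be the closed \<open>G\<close>-invariant subspace of those
  vectors on which every functional \<open>\<alpha> k\<close> vanishes.  Then \<open>V/A\<close> is again Rosenthal (a copy of
  \<open>\<ell>\<^sub>1\<close> in a quotient lifts), it carries the quotient representation of \<open>G\<close>, \<open>\<alpha>\<close> factors
  through its dual ball, and \<open>v + A \<mapsto> (\<lambda>k. \<alpha> k v)\<close> is a linear injection of \<open>V/A\<close> into the
  functions on \<open>K\<close>.
\<close>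

definition rosenthal_representable ::
  "('g, 'r) monoid_scheme \<Rightarrow> 'g topology \<Rightarrow> 'k topology \<Rightarrow> ('g \<Rightarrow> 'k \<Rightarrow> 'k) \<Rightarrow> bool"
  where "rosenthal_representable G TG K act \<longleftrightarrow>
    (\<exists>(V :: ('k \<Rightarrow> real) set) N h \<alpha>. rosenthal_representation G TG K act V N h \<alpha>)"

end

theory Submission
  imports Defs "HOL-Real_Asymp.Real_Asymp"
begin

text \<open>
  If \<open>k\<close> halfspaces are shattered by the points of \<open>X\<close>, then the cube \<open>{0, 1}\<^sup>k\<close> embeds in \<open>X\<close>; so
  finite rank bounds the Vapnik-Chervonenkis dimension of the family of halfspaces, and by
  Sauer-Shelah \<open>k\<close> of them have only polynomially many patterns.  An exponential moment estimate
  shows that Rademacher averages of the coordinate functions on \<open>X\<^sup>R\<close> are \<open>o(k)\<close> in the supremum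
  norm, and by convexity the same holds on their absolutely convex hull \<open>W\<close>.  Interpolating between
  \<open>W\<close> and the unit ball of the supremum norm in the manner of Davis, Figiel, Johnson and Pelczynski
  gives a Banach space of continuous functions without a copy of \<open>\<ell>\<^sub>1\<close>.  The construction is invariant
  under \<open>G\<close>, and the point evaluations embed \<open>X\<^sup>R\<close> in the dual ball.
\<close>

section \<open>The distributive law in median algebras\<close>

text \<open>Points realising all cells of a shattered family of halfspaces need not be closed under
  the median, so shattering does not display a cube directly. The points have to be moved inside
  their cells, and the computations for this rest on the distributive law, which is first derived
  from the axioms. The space of all continuous functions on \<open>X^R\<close> cannot serve as
  target, since it may contain \<open>ell1\<close>. Rademacher averages are used because, unlike a
  count of 0/1 patterns, their smallness makes sense on convex hulls and passes to them; it also
  contradicts a lower \<open>ell1\<close> estimate quantitatively, without Rosenthal's dichotomy for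
  bounded sequences. Each single gauge is equivalent to the supremum norm, but with constants that
  degrade with the level. A vector can therefore be uniformly small and still have large norm, and
  excluding \<open>ell1\<close> needs an argument across the levels.\<close>

context median_algebra
begin

text \<open>The middle argument is the point in between: \<open>c \<in> [a, b]\<close>.\<close>

definition between :: "'a \<Rightarrow> 'a \<Rightarrow> 'a \<Rightarrow> bool"
  where "between a c b \<longleftrightarrow> m a b c = c"

lemma swap13: "\<lbrakk>a \<in> X; b \<in> X; c \<in> X\<rbrakk> \<Longrightarrow> m c b a = m a b c"
  by (metis swap12 swap23)

lemma rot: "\<lbrakk>a \<in> X; b \<in> X; c \<in> X\<rbrakk> \<Longrightarrow> m b c a = m a b c"
  by (metis swap12 swap23)

lemma majority':
  assumes "a \<in> X" "b \<in> X"
  shows "m b a b = b" "m b b a = b"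
  using assms majority swap12[of b a b] swap23[of b b a] by auto

text \<open>With \<open>x\<close> as base point, \<open>m x a b\<close> is a meet operation, and
  this is its associativity. Accordingly \<open>between x a b\<close> reads \<open>a \<le> b\<close>
  in a semilattice with least element \<open>x\<close>.\<close>

lemma base_assoc:
  assumes "x \<in> X" "a \<in> X" "b \<in> X" "c \<in> X"
  shows "m x (m x a b) c = m x a (m x b c)"
  using assoc[of a b c x] assms by (simp add: swap12 closed)

lemma between_sym:
  assumes "between a c b" "a \<in> X" "b \<in> X" "c \<in> X"
  shows "between b c a"
  using assms swap12[of a b c] by (simp add: between_def)

lemma between_eqs:
  assumes "between a c b" "a \<in> X" "b \<in> X" "c \<in> X"
  shows "m a b c = c" "m b a c = c" "m a c b = c" "m b c a = c" "m c a b = c" "m c b a = c"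
  using assms(1) swap12[of a b c] swap23[of a b c] swap13[of a b c] rot[of a b c] rot[of c a b]
    assms(2-) by (simp_all add: between_def)

lemma betweenI:
  assumes "m a c b = c" "a \<in> X" "b \<in> X" "c \<in> X"
  shows "between a c b"
  using assms swap23[of a b c] by (simp add: between_def)

lemma median_between12:
  assumes "a \<in> X" "b \<in> X" "c \<in> X"
  shows "between a (m a b c) b"
  using base_assoc[of a b b c] assms by (simp add: between_def majority)

lemma median_between:
  assumes "a \<in> X" "b \<in> X" "c \<in> X"
  shows "between a (m a b c) b" "between a (m a b c) c" "between b (m a b c) c"
    "between b (m a b c) a" "between c (m a b c) a" "between c (m a b c) b"
proof -
  show *: "between a (m a b c) b" "between a (m a b c) c" "between b (m a b c) c"
    using median_between12[of a b c] median_between12[of a c b] median_between12[of b c a] assms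
      swap23[of a b c] rot[of a b c] by auto
  show "between b (m a b c) a" "between c (m a b c) a" "between c (m a b c) b"
    using * assms closed between_sym by simp_all
qed

lemma meet_mono:
  assumes X: "a \<in> X" "c \<in> X" "x \<in> X" "y \<in> X" and "between a c x" "between a c y"
  shows "between a c (m a x y)"
proof (rule betweenI)
  have "m a c (m a x y) = m a (m a c x) y" using X by (simp add: base_assoc)
  also have "\<dots> = c" using between_eqs assms by simp
  finally show "m a c (m a x y) = c" .
qed (use X closed in auto)

lemma between_trans:
  assumes X: "a \<in> X" "b \<in> X" "c \<in> X" "t \<in> X" and "between a c b" "between a b t"
  shows "between a c t"
proof (rule betweenI)
  have "m a c t = m a (m a c b) t" using between_eqs assms by simp
  also have "\<dots> = m a c (m a b t)" using X by (simp add: base_assoc)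
  also have "\<dots> = c" using between_eqs assms by simp
  finally show "m a c t = c" .
qed (use X in auto)

text \<open>A chain \<open>c\<close>, \<open>b\<close>, \<open>t\<close> in the order based at
  \<open>a\<close> stays a chain when the base point moves up to \<open>c\<close>.\<close>

lemma between_trans2:
  assumes X: "a \<in> X" "b \<in> X" "c \<in> X" "t \<in> X" and "between a c b" "between a b t"
  shows "between c b t"
proof -
  have c: "m b a c = c" and b: "m b t a = b" using assms between_eqs by simp_all
  have "m c t b = m b t (m b a c)" using X c swap13[of b t c] by simp
  also have "\<dots> = m b (m b t a) c" using X by (simp add: base_assoc)
  finally show ?thesis using X b by (simp add: between_def majority')
qed

text \<open>A candidate \<open>z\<close> lies below the median in the orders based at
  \<open>a\<close> and at \<open>b\<close>. The first puts the median between \<open>z\<close> and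
  \<open>b\<close>, the second puts \<open>z\<close> between \<open>b\<close> and the median, and
  the two equations identify them.\<close>

lemma median_unique:
  assumes X: "a \<in> X" "b \<in> X" "c \<in> X" "z \<in> X"
    and z: "between a z b" "between b z c" "between a z c"
  shows "m a b c = z"
proof -
  let ?t = "m a b c"
  have t: "?t \<in> X" using X closed by simp
  have "between a z ?t" using meet_mono[of a z b c] X z by simp
  moreover have "between a ?t b" using X median_between by simp
  ultimately have *: "between z ?t b" using between_trans2[of a ?t z b] X t by simp
  have "between b z ?t" using meet_mono[of b z a c] X z between_sym swap12[of a b c] by simp
  then show ?thesis using between_eqs[OF *] between_eqs[of b z ?t] X t by simp
qed

text \<open>Since \<open>m a x t\<close> lies between \<open>x\<close> and \<open>t\<close>, it may
  replace \<open>x\<close> as an end point; then \<open>y\<close> is replaced likewise.\<close>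

lemma between_meets:
  assumes X: "a \<in> X" "x \<in> X" "y \<in> X" "t \<in> X" and t: "between x t y"
  shows "between (m a x t) t (m a y t)"
proof -
  let ?p = "m a x t" and ?q = "m a y t"
  have X': "?p \<in> X" "?q \<in> X" using X closed by auto
  have "between ?p t y" using between_trans2[of x t ?p y] median_between[of a x t] X X' t by simp
  then have *: "between y t ?p" using X X' between_sym by simp
  have "between y ?q t" using X median_between by simp
  then have "between ?q t ?p" using between_trans2[of y t ?q ?p] X X' * by simp
  then show ?thesis using X X' between_sym by simp
qed

text \<open>The meet \<open>?r\<close> of \<open>e\<close> and \<open>t\<close> lies between
  \<open>e\<close> and each of the meets of \<open>e\<close> with \<open>p\<close> and
  \<open>q\<close>. Since \<open>e\<close> is between these two meets, \<open>?r\<close> can only be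
  \<open>e\<close>. This is convexity of intervals.\<close>

lemma interval_closed:
  assumes X: "a \<in> X" "t \<in> X" "p \<in> X" "q \<in> X" "e \<in> X"
    and p: "between a p t" and q: "between a q t" and e: "between p e q"
  shows "between a e t"
proof -
  let ?p = "m a p e" and ?q = "m a q e" and ?r = "m a e t"
  have X': "?p \<in> X" "?q \<in> X" "?r \<in> X" using X closed by auto
  have e': "between ?p e ?q" using between_meets X e by simp
  have re: "between a ?r e" using X median_between by simp
  have *: "between e ?r (m a s e)" if s: "s \<in> X" "between a s t" for s
  proof -
    let ?s = "m a s e"
    have sX: "?s \<in> X" using s X closed by simp
    have se: "between a ?s e" using X s median_between by simp
    moreover have "between a ?s t"
      using between_trans[of a s ?s t] X s sX median_between by simp
    ultimately have "between a ?s ?r" using meet_mono X sX by simp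
    then have "between ?s ?r e" using between_trans2[of a ?r ?s e] X X' sX re by simp
    then show ?thesis using X X' sX between_sym by simp
  qed
  have "between e ?r (m e ?p ?q)"
    using meet_mono[of e ?r ?p ?q] *[of p] *[of q] X X' p q by simp
  moreover have "m e ?p ?q = e" using between_eqs[OF e'] X X' by simp
  ultimately have "?r = e" using X X' by (simp add: between_def majority')
  then show ?thesis using X betweenI by simp
qed

text \<open>It suffices that \<open>c\<close> lies below the median \<open>?e\<close> of
  \<open>c\<close>, \<open>p\<close>, \<open>q\<close> in the order based at \<open>a\<close>. With
  \<open>t\<close> read as the join of \<open>p\<close> and \<open>q\<close>, the result is the
  distributive law for the meet of \<open>c\<close> with that join.\<close>

lemma join_meet:
  assumes X: "a \<in> X" "t \<in> X" "p \<in> X" "q \<in> X" "c \<in> X"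
    and p: "between a p t" and q: "between a q t" and c: "between a c t" and t: "between p t q"
  shows "between (m a c p) c (m a c q)"
proof -
  let ?e = "m c p q" and ?P = "m t p c" and ?Q = "m t q c"
  have X': "?e \<in> X" "?P \<in> X" "?Q \<in> X" using X closed by auto
  have epq: "between p ?e q" using X median_between by simp
  have et: "between a ?e t" using interval_closed[of a t p q] X X' p q epq by simp
  have *: "m t r (m r s c) = m t r c" if "r \<in> X" "s \<in> X" "between r t s" for r s
  proof -
    have "m t r (m r s c) = m r t (m r s c)" using X that closed swap12[of t r] by simp
    also have "\<dots> = m r (m r t s) c" using X that base_assoc by simp
    also have "\<dots> = m r t c" using X that between_eqs by simp
    also have "\<dots> = m t r c" using X that swap12 by simp
    finally show ?thesis .
  qed
  have eP: "m t p ?e = ?P" using *[of p q] X t rot[of c p q] by simp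
  have eQ: "m t q ?e = ?Q" using *[of q p] X t between_sym swap13[of c p q] by simp
  have ePQ: "between ?P ?e ?Q" using between_meets[of t p q ?e] X X' epq eP eQ by simp
  have **: "between ?e (m t r ?e) t \<Longrightarrow> r \<in> X \<Longrightarrow> between (m t r ?e) ?e a" for r
    using between_trans2[of t ?e "m t r ?e" a] between_sym et X X' closed by simp
  have aP: "between ?P ?e a" "between ?Q ?e a"
    using **[of p] **[of q] eP eQ median_between[of t p ?e] median_between[of t q ?e] X X'
    by simp_all
  \<comment> \<open>\<open>?e\<close> is the meet of \<open>?P\<close> and \<open>?Q\<close> in the
    order based at \<open>a\<close>, and both of these lie above \<open>c\<close>, being between
    \<open>t\<close> and \<open>c\<close>.\<close>
  have eq: "m a ?P ?Q = ?e"
    by (rule median_unique) (use X X' ePQ aP between_sym in simp_all)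
  have tc: "between t c a" using c X between_sym by simp
  have "between ?P c a" "between ?Q c a"
    using between_trans2[of t c ?P a] between_trans2[of t c ?Q a] median_between[of t p c]
      median_between[of t q c] tc X X' by simp_all
  then have "between a c ?P" "between a c ?Q" using X X' between_sym by simp_all
  then have ce: "between a c ?e" using meet_mono[of a c ?P ?Q] eq X X' by simp
  have "m c (m c a p) (m c a q) = m c a (m c p (m c a q))" using X closed base_assoc by simp
  also have "m c p (m c a q) = m c (m c a q) p" using X closed swap23 by simp
  also have "\<dots> = m c a (m c q p)" using X base_assoc by simp
  also have "m c a (m c a (m c q p)) = m c (m c a a) (m c q p)"
    using X closed base_assoc by simp
  also have "\<dots> = m c a ?e" using X majority swap23 by simp
  also have "\<dots> = c" using between_eqs[OF ce] X X' by simp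
  finally show ?thesis
    using X closed swap12[of a c] rot[of c "m c a p" "m c a q"] by (simp add: between_def)
qed

lemma meet_idem:
  assumes X: "a \<in> X" "b \<in> X" "x \<in> X" "y \<in> X"
  shows "m a (m a b x) (m a b y) = m a b (m a x y)"
proof -
  have "m a (m a b x) (m a b y) = m a b (m a x (m a b y))" using X closed base_assoc by simp
  also have "m a x (m a b y) = m a (m a b y) x" using X closed swap23 by simp
  also have "\<dots> = m a b (m a y x)" using X base_assoc by simp
  also have "m a b (m a b (m a y x)) = m a (m a b b) (m a y x)"
    using X closed base_assoc by simp
  also have "\<dots> = m a b (m a x y)" using X majority swap23 by simp
  finally show ?thesis .
qed

text \<open>The semilattice with base point \<open>a\<close>: \<open>t\<close> is first compared with its meets with \<open>x\<close> and \<open>y\<close>, which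
  reduces the claim to the case of a join of two elements below \<open>t\<close>, treated in \<open>join_meet\<close>.\<close>

lemma median_monotone:
  assumes X: "a \<in> X" "b \<in> X" "x \<in> X" "y \<in> X" "t \<in> X" and t: "between x t y"
  shows "between (m a b x) (m a b t) (m a b y)"
proof -
  let ?p = "m a x t" and ?q = "m a y t" and ?s = "m a x y"
  let ?X = "m a b x" and ?Y = "m a b y" and ?T = "m a b t"
  let ?P = "m a ?X ?T" and ?Q = "m a ?Y ?T" and ?S = "m a ?X ?Y" and ?M = "m ?X ?Y ?T"
  have X1: "?p \<in> X" "?q \<in> X" "?s \<in> X" "?X \<in> X" "?Y \<in> X" "?T \<in> X" using X closed by auto
  have X2: "?P \<in> X" "?Q \<in> X" "?S \<in> X" "?M \<in> X" using X X1 closed by auto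
  have pq: "between ?p t ?q" using between_meets X t by simp
  have pt: "between a ?p t" "between a ?q t" using X median_between by simp_all
  have Tt: "between a ?T t" using X median_between by simp
  have Tm: "m a ?T (m a z t) = m a (m a b z) ?T" if "z \<in> X" for z
  proof -
    have "m a ?T (m a z t) = m a b (m a t (m a z t))" using X that closed base_assoc by simp
    also have "m a t (m a z t) = m a z t"
      using between_eqs[OF median_between(2)[of a z t]] X that closed by simp
    also have "m a b (m a z t) = m a (m a b z) ?T" using X that meet_idem by simp
    finally show ?thesis .
  qed
  \<comment> \<open>By \<open>pq\<close>, \<open>t\<close> is the join of \<open>?p\<close> and
    \<open>?q\<close>; distributivity makes \<open>?T\<close> the join of its meets with
    \<open>?X\<close> and \<open>?Y\<close>.\<close>
  have PTQ: "between ?P ?T ?Q"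
    using join_meet[of a t ?p ?q ?T] X X1 pt Tt pq Tm by simp
  have st: "between a ?s t"
  proof -
    have "m x ?s t = m x (m x a y) t" using X swap12[of a x y] by simp
    also have "\<dots> = m x a (m x y t)" using X base_assoc by simp
    also have "\<dots> = ?p" using between_eqs[OF t] X swap12 by simp
    finally have "between x ?p ?s" using X X1 median_between[of x ?s t] by simp
    moreover have "between x ?s a" using X median_between by simp
    ultimately have "between ?p ?s a" using between_trans2[of x ?s ?p a] X X1 by simp
    then have "between a ?s ?p" using X X1 between_sym by simp
    then show ?thesis using pt between_trans[of a ?p ?s t] X X1 by simp
  qed
  have ST: "between a ?S ?T"
  proof (rule betweenI)
    have "m a ?S ?T = m a (m a b ?s) (m a b t)" using X meet_idem by simp
    also have "\<dots> = m a b (m a ?s t)" using X X1 meet_idem by simp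
    also have "\<dots> = ?S" using between_eqs[OF st] X X1 meet_idem by simp
    finally show "m a ?S ?T = ?S" .
  qed (use X X1 X2 in auto)
  have aS: "between a ?S ?X" "between a ?S ?Y" using X X1 median_between by simp_all
  have SP: "between a ?S ?P" "between a ?S ?Q"
    using ST aS X X1 X2 meet_mono by simp_all
  have aP: "between a ?P ?X" "between a ?P ?T" "between a ?Q ?Y" "between a ?Q ?T"
    using X X1 median_between by simp_all
  \<comment> \<open>\<open>?M\<close> and \<open>?T\<close> have the same meets with
    \<open>?X\<close> and \<open>?Y\<close>, so both lie between \<open>?P\<close> and
    \<open>?Q\<close>; with \<open>?T\<close> below \<open>?M\<close> this forces equality.\<close>
  have MX: "m a ?X ?M = ?P"
  proof -
    have "m a ?X ?M = m ?X a (m ?X ?Y ?T)" using X X1 X2 swap12[of a ?X] by simp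
    also have "\<dots> = m (m ?X a ?Y) ?X ?T" 
      using X X1 closed base_assoc[of ?X a ?Y ?T] swap12[of ?X "m ?X a ?Y" ?T] by simp
    also have "\<dots> = m ?S ?X ?T" using X X1 swap12[of a ?X ?Y] by simp
    also have "\<dots> = ?P"
    proof (rule median_unique)
      show "between ?S ?P ?X" "between ?S ?P ?T"
        using between_trans2[of a ?P ?S] SP aP X X1 X2 by simp_all
      show "between ?X ?P ?T" using X X1 median_between by simp
    qed (use X X1 X2 in auto)
    finally show ?thesis .
  qed
  have MY: "m a ?Y ?M = ?Q"
  proof -
    have "m a ?Y ?M = m ?Y a (m ?Y ?X ?T)"
      using X X1 X2 swap12[of a ?Y] swap12[of ?X ?Y ?T] by simp
    also have "\<dots> = m (m ?Y a ?X) ?Y ?T" 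
      using X X1 closed base_assoc[of ?Y a ?X ?T] swap12[of ?Y "m ?Y a ?X" ?T] by simp
    also have "\<dots> = m ?S ?Y ?T" using X X1 rot[of a ?X ?Y] rot[of ?Y a ?X] by simp
    also have "\<dots> = ?Q"
    proof (rule median_unique)
      show "between ?S ?Q ?Y" "between ?S ?Q ?T"
        using between_trans2[of a ?Q ?S] SP aP X X1 X2 by simp_all
      show "between ?Y ?Q ?T" using X X1 median_between by simp
    qed (use X X1 X2 in auto)
    finally show ?thesis .
  qed
  have PMQ: "between ?P ?M ?Q"
    using between_meets[of a ?X ?Y ?M] X X1 X2 MX MY median_between(1)[of ?X ?Y ?T] by simp
  have TM: "between a ?T ?M"
  proof (rule betweenI)
    have "m a ?T ?M = m ?T a (m ?T ?X ?Y)"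
      using X X1 X2 swap12[of a ?T ?M] rot[of ?T ?X ?Y] by simp
    also have "\<dots> = m ?T (m ?T a ?X) (m ?T a ?Y)" using X X1 meet_idem by simp
    also have "\<dots> = m ?T ?P ?Q" using X X1 rot[of ?T a ?X] rot[of ?T a ?Y] by simp
    also have "\<dots> = ?T" using between_eqs[OF PTQ] X1 X2 by simp
    finally show "m a ?T ?M = ?T" .
  qed (use X X1 X2 in auto)
  have PT: "between ?P ?T ?M" "between ?Q ?T ?M"
    using between_trans2[of a ?T] aP TM X X1 X2 by simp_all
  have "m ?P ?Q ?M = ?T" using median_unique[of ?P ?Q ?M ?T] X1 X2 PTQ PT by simp
  then have "?M = ?T" using between_eqs[OF PMQ] X2 by simp
  then show ?thesis by (simp add: between_def)
qed

text \<open>By \<open>median_monotone\<close> the image of the median lies between each pair of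
  images, so uniqueness of medians applies.\<close>

lemma median_distrib:
  assumes "a \<in> X" "b \<in> X" "x \<in> X" "y \<in> X" "z \<in> X"
  shows "m a b (m x y z) = m (m a b x) (m a b y) (m a b z)"
  by (rule median_unique[symmetric]) (use assms closed median_monotone median_between in simp_all)

end

section \<open>Shattered halfspaces and cubes\<close>

text \<open>Two of the three points lie on the same side, and convexity of that side captures the
  median. Membership in a halfspace thus behaves like a coordinate of a cube.\<close>

lemma halfspace_median:
  assumes "median_algebra X m" "median_convex X m H" "median_convex X m (X - H)"
    and X: "x \<in> X" "y \<in> X" "z \<in> X"
  shows "m x y z \<in> H \<longleftrightarrow> x \<in> H \<and> y \<in> H \<or> y \<in> H \<and> z \<in> H \<or> x \<in> H \<and> z \<in> H"
proof -
  interpret median_algebra X m by fact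
  have mX: "m x y z \<in> X" using X closed by simp
  have conv: "m x y z \<in> C"
    if C: "median_convex X m C" and "x \<in> C \<and> y \<in> C \<or> y \<in> C \<and> z \<in> C \<or> x \<in> C \<and> z \<in> C" for C
    using that median_between[OF X] mX
    unfolding median_convex_def median_interval_def between_def by blast
  show ?thesis using conv[OF assms(2)] conv[OF assms(3)] X mX by blast
qed

lemma cube_median_apply:
  "i < n \<Longrightarrow> cube_median n x y z i \<longleftrightarrow> x i \<and> y i \<or> y i \<and> z i \<or> x i \<and> z i"
  by (simp add: cube_median_def)

lemma cube_median_mem: "cube_median n x y z \<in> cube n"
  by (simp add: cube_median_def cube_def)

lemma cube_eqI:
  assumes "x \<in> cube n" "y \<in> cube n" "\<And>i. i < n \<Longrightarrow> x i = y i"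
  shows "x = y"
  using assms unfolding cube_def by (intro PiE_ext[of x "{..<n}" "\<lambda>_. UNIV" y]) auto

lemma restrict_mem_cube: "restrict x {..<n} \<in> cube n"
  by (simp add: cube_def)

lemma restrict_cube_median:
  assumes "n \<le> k"
  shows "restrict (cube_median k x y z) {..<n}
    = cube_median n (restrict x {..<n}) (restrict y {..<n}) (restrict z {..<n})"
  using assms by (auto simp: cube_median_def fun_eq_iff)

context median_algebra
begin

text \<open>In the lattice \<open>[w, u]\<close>, \<open>m u b\<close> is the join with \<open>b\<close>, and \<open>between y w b\<close> says that \<open>y\<close> and \<open>b\<close> are
  disjoint.\<close>

lemma join_cases:
  assumes X: "w \<in> X" "u \<in> X" "b \<in> X" "y1 \<in> X" "y2 \<in> X" "y3 \<in> X"
    and y1: "between w y1 u"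
    and y: "between y2 w b" "between y3 w b"
  shows "m (m u b y1) (m u b y2) (m u b y3) = m u b (m y1 y2 y3)"
    and "m (m u b y1) (m u b y2) y3 = m u b (m y1 y2 y3)"
    and "m (m u b y1) y2 y3 = m y1 y2 y3"
proof -
  let ?J = "m u b"
  have JX: "?J y1 \<in> X" "?J y2 \<in> X" "?J y3 \<in> X" using X closed by simp_all
  show 3: "m (?J y1) (?J y2) (?J y3) = ?J (m y1 y2 y3)" using median_distrib X by simp
  let ?M = "m (?J y1) (?J y2) y3"
  have MX: "?M \<in> X" using X JX closed by simp
  have J: "between b (?J y) u" if "y \<in> X" for y using that X median_between by simp
  have idem: "?J y = y" if "between b y u" "y \<in> X" for y
    using between_eqs[OF that(1)] that X by simp
  \<comment> \<open>Being in the interval from \<open>b\<close> to \<open>u\<close>,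
    \<open>?M\<close> is fixed by \<open>?J\<close>, which then distributes over the median.\<close>
  have "between b ?M u"
    using interval_closed[of b u "?J y1" "?J y2"] J X JX MX median_between(1) by simp
  then have "?M = ?J ?M" using idem MX by simp
  also have "\<dots> = m (?J (?J y1)) (?J (?J y2)) (?J y3)" using X JX median_distrib by simp
  also have "\<dots> = ?J (m y1 y2 y3)" using idem J X JX 3 by simp
  finally show "?M = ?J (m y1 y2 y3)" .
  \<comment> \<open>Because \<open>w\<close> separates \<open>b\<close> from \<open>y2\<close> and
    \<open>y3\<close>, the point \<open>b\<close> acts in medians with these two like
    \<open>w\<close>.\<close>
  have v: "between y (m y2 y3 w) b" if "y \<in> {y2, y3}" for y
    using that between_trans[of y w "m y2 y3 w" b] y X closed median_between by auto
  have b: "m y2 y3 b = m y2 y3 w"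
    by (rule median_unique) (use v X closed median_between in simp_all)
  have "m (?J y1) y2 y3 = m y2 y3 (?J y1)" using X JX rot by simp
  also have "\<dots> = m (m y2 y3 u) (m y2 y3 w) (m y2 y3 y1)" using X median_distrib b by simp
  also have "\<dots> = m y2 y3 (m u w y1)" using X median_distrib by simp
  also have "\<dots> = m y1 y2 y3" using between_eqs[OF y1] X rot by simp
  finally show "m (?J y1) y2 y3 = m y1 y2 y3" .
qed

text \<open>The cube is built one coordinate at a time.  Given the cube \<open>f\<close> for the first \<open>j\<close> coordinates and a
  point \<open>b0\<close> in the cell \<open>{j}\<close>, the bottom is raised to \<open>w\<close>, the meet of \<open>b0\<close> with the top of the cube;
  this makes the raised cube disjoint from the raised \<open>b0\<close>, so that joining with the latter
  provides the parallel copy.\<close>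

lemma shattered_cube:
  assumes H: "\<And>i. i < k \<Longrightarrow> median_convex X m (H i) \<and> median_convex X m (X - H i)"
    and shatter: "\<And>S. S \<subseteq> {..<k} \<Longrightarrow> \<exists>x\<in>X. \<forall>i<k. x \<in> H i \<longleftrightarrow> i \<in> S"
  shows "\<exists>f. inj_on f (cube k) \<and> median_hom (cube k) (cube_median k) X m f"
proof -
  obtain u where u: "u \<in> X" "\<And>i. i < k \<Longrightarrow> u \<in> H i" using shatter[of "{..<k}"] by auto
  have Hm: "m x y z \<in> H i \<longleftrightarrow> x \<in> H i \<and> y \<in> H i \<or> y \<in> H i \<and> z \<in> H i \<or> x \<in> H i \<and> z \<in> H i"
    if "i < k" "x \<in> X" "y \<in> X" "z \<in> X" for i x y z
    using halfspace_median[OF median_algebra_axioms, of "H i" x y z] H that by blast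
  define F where "F j = (\<lambda>i\<in>{..<j}. False)" for j :: nat
  define T where "T j = (\<lambda>i\<in>{..<j}. True)" for j :: nat
  have FT': "F j i = False" "T j i = True" if "i < j" for i j
    using that by (simp_all add: F_def T_def)
  have FTr: "restrict (F (Suc j)) {..<j} = F j" "restrict (T (Suc j)) {..<j} = T j" for j
    by (auto simp: F_def T_def fun_eq_iff)
  \<comment> \<open>The vertices avoid all halfspaces from index \<open>j\<close> on, which leaves
    these free for later steps. The last conjunct keeps the cube in the interval from its bottom to
    \<open>u\<close>.\<close>
  have "\<exists>f. median_hom (cube j) (cube_median j) X m f \<and>
      (\<forall>e\<in>cube j. \<forall>i<k. f e \<in> H i \<longleftrightarrow> i < j \<and> e i) \<and> between (f (F j)) (f (T j)) u"
    if "j \<le> k" for j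
    using that
  proof (induction j)
    case 0
    obtain x where "x \<in> X" "\<forall>i<k. x \<notin> H i" using shatter[of "{}"] by auto
    then show ?case
      using u majority' majority
      by (intro exI[of _ "\<lambda>_. x"]) (auto simp: median_hom_def between_def swap12)
  next
    case (Suc j)
    then have j: "j < k" by simp
    from Suc obtain f where f: "median_hom (cube j) (cube_median j) X m f"
      and fH: "\<And>e i. e \<in> cube j \<Longrightarrow> i < k \<Longrightarrow> f e \<in> H i \<longleftrightarrow> i < j \<and> e i"
      and fu: "between (f (F j)) (f (T j)) u" by auto
    have fX: "f e \<in> X" if "e \<in> cube j" for e using f that by (auto simp: median_hom_def)
    have fm: "f (cube_median j x y z) = m (f x) (f y) (f z)"
      if "x \<in> cube j" "y \<in> cube j" "z \<in> cube j" for x y z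
      using f that by (auto simp: median_hom_def)
    have FT: "F j \<in> cube j" "T j \<in> cube j" unfolding F_def T_def by (rule restrict_mem_cube)+
    obtain b0 where b0: "b0 \<in> X" "\<And>i. i < k \<Longrightarrow> b0 \<in> H i \<longleftrightarrow> i = j"
      using shatter[of "{j}"] j by auto
    define z where "z = f (F j)"
    define B where "B = f (T j)"
    \<comment> \<open>At most one of \<open>z\<close>, \<open>B\<close>, \<open>b0\<close> lies in
      any given halfspace, so the new bottom \<open>w\<close> avoids all of them.\<close>
    define w where "w = m z B b0"
    define b where "b = m u w b0"
    \<comment> \<open>As \<open>u\<close> lies in every halfspace and \<open>w\<close> in none, the
      median with both leaves every membership unchanged.\<close>
    define g where "g e = m u w (f e)" for e
    \<comment> \<open>Among the halfspaces, \<open>b\<close> lies in \<open>H j\<close> only, so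
      \<open>J\<close> moves a point into \<open>H j\<close> and changes no other
      membership.\<close>
    define J where "J y = m u b y" for y
    define f' where "f' e = (if e j then J (g (restrict e {..<j})) else g (restrict e {..<j}))" for e
    have X: "z \<in> X" "B \<in> X" "w \<in> X" "b \<in> X" "b0 \<in> X" "u \<in> X"
      unfolding z_def B_def w_def b_def using FT fX b0 u closed by simp_all
    have gX: "g e \<in> X" if "e \<in> cube j" for e
      unfolding g_def using that fX X closed by simp
    have JX: "J y \<in> X" if "y \<in> X" for y unfolding J_def using that X closed by simp
    have zBu: "between z B u" using fu z_def B_def by simp
    have zw: "between z w B" "between B w b0" unfolding w_def using X median_between by simp_all
    have zu: "between z w u" using between_trans[of z B w u] zw zBu X by simp
    have gz: "m u w z = w" using between_eqs[OF zu] X by simp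
    have gw: "m u w w = w" using X majority by simp
    have B'b: "between (m u w B) w b"
      using median_monotone[of u w B b0 w] zw X gw by (simp add: b_def)
    have wg: "between w (g e) u" if "e \<in> cube j" for e
      unfolding g_def using X fX that median_between by simp
    have gwb: "between (g e) w b" if e: "e \<in> cube j" for e
    proof -
      have "cube_median j (F j) (T j) e = e"
        by (rule cube_eqI[of _ j]) (use e cube_median_mem in \<open>auto simp: cube_median_apply FT'\<close>)
      then have "m z B (f e) = f e" using fm[of "F j" "T j" e] FT e by (simp add: z_def B_def)
      then have "between z (f e) B" by (simp add: between_def)
      then have "between w (g e) (m u w B)"
        using median_monotone[of u w z B "f e"] X fX[OF e] gz by (simp add: g_def)
      then show ?thesis
        using between_trans2[of "m u w B" w "g e" b] B'b X gX[OF e] closed between_sym by simp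
    qed
    have gm: "g (cube_median j x y z) = m (g x) (g y) (g z)"
      if "x \<in> cube j" "y \<in> cube j" "z \<in> cube j" for x y z
      using that fX fm X median_distrib by (simp add: g_def)
    have hom: "f' (cube_median (Suc j) p q r) = m (f' p) (f' q) (f' r)" for p q r
    proof -
      let ?p = "g (restrict p {..<j})" and ?q = "g (restrict q {..<j})"
        and ?r = "g (restrict r {..<j})"
      have pqr: "?p \<in> X" "?q \<in> X" "?r \<in> X" by (simp_all add: gX restrict_mem_cube)
      have Jp: "J ?p \<in> X" "J ?q \<in> X" "J ?r \<in> X" by (simp_all add: pqr JX)
      have 1: "g (restrict (cube_median (Suc j) p q r) {..<j}) = m ?p ?q ?r"
        by (simp add: restrict_cube_median gm restrict_mem_cube)
      have 2: "f' (cube_median (Suc j) p q r)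
          = (if p j \<and> q j \<or> q j \<and> r j \<or> p j \<and> r j then J (m ?p ?q ?r) else m ?p ?q ?r)"
        by (simp add: f'_def cube_median_apply 1)
      have JC: "m (J y1) (J y2) (J y3) = J (m y1 y2 y3)" "m (J y1) (J y2) y3 = J (m y1 y2 y3)"
        "m (J y1) y2 y3 = m y1 y2 y3"
        if "y1 \<in> {?p, ?q, ?r}" "y2 \<in> {?p, ?q, ?r}" "y3 \<in> {?p, ?q, ?r}" for y1 y2 y3
        using that X pqr join_cases[of w u b y1 y2 y3] wg gwb restrict_mem_cube
        unfolding J_def by blast+
      \<comment> \<open>Up to permuting the arguments only the number of true coordinates matters,
        and \<open>join_cases\<close> treats three, two and one.\<close>
      consider "p j" "q j" "r j" | "p j" "q j" "\<not> r j" | "p j" "\<not> q j" "r j"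
        | "p j" "\<not> q j" "\<not> r j" | "\<not> p j" "q j" "r j" | "\<not> p j" "q j" "\<not> r j"
        | "\<not> p j" "\<not> q j" "r j" | "\<not> p j" "\<not> q j" "\<not> r j" by blast
      then show ?thesis
      proof cases
        case 3
        then show ?thesis
          using 2 JC(2)[of ?p ?r ?q] swap23[of "J ?p" "J ?r" ?q] swap23[of ?p ?r ?q] pqr Jp
          by (simp add: f'_def)
      next
        case 5
        then show ?thesis
          using 2 JC(2)[of ?q ?r ?p] rot[of ?p "J ?q" "J ?r"] rot[of ?p ?q ?r] pqr Jp
          by (simp add: f'_def)
      next
        case 6
        then show ?thesis
          using 2 JC(3)[of ?q ?p ?r] swap12[of "J ?q" ?p ?r] swap12[of ?q ?p ?r] pqr Jp
          by (simp add: f'_def)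
      next
        case 7
        then show ?thesis
          using 2 JC(3)[of ?r ?p ?q] rot[of "J ?r" ?p ?q] rot[of ?r ?p ?q] pqr Jp
          by (simp add: f'_def)
      qed (use 2 JC[of ?p ?q ?r] in \<open>simp_all add: f'_def\<close>)
    qed
    have f'X: "f' e \<in> X" for e by (simp add: f'_def gX JX restrict_mem_cube)
    have wH: "w \<notin> H i" if "i < k" for i
      using that fH FT b0 Hm[of i z B b0] X by (auto simp: w_def z_def B_def FT')
    have gH: "g e \<in> H i \<longleftrightarrow> i < j \<and> e i" if "e \<in> cube j" "i < k" for e i
      using that wH u Hm[of i u w "f e"] X fX fH by (auto simp: g_def)
    have bH: "b \<in> H i \<longleftrightarrow> i = j" if "i < k" for i
      using that wH u Hm[of i u w b0] X b0 by (auto simp: b_def)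
    have f'H: "f' e \<in> H i \<longleftrightarrow> i < Suc j \<and> e i" if "e \<in> cube (Suc j)" "i < k" for e i
      using that gH[OF restrict_mem_cube, of i e] bH[of i] u(2)[of i] u(1) X gX[OF restrict_mem_cube, of e]
        Hm[of i u b "g (restrict e {..<j})"]
      by (auto simp: f'_def J_def less_Suc_eq)
    have "f' (F (Suc j)) = w"
      using gz by (simp add: f'_def g_def z_def FTr FT')
    moreover have "between w (f' (T (Suc j))) u"
    proof -
      let ?y = "g (restrict (T (Suc j)) {..<j})"
      have y: "?y \<in> X" by (simp add: gX restrict_mem_cube)
      have "between u (J ?y) b" "between u b w"
        using X y median_between b_def by (simp_all add: J_def)
      then have "between u (J ?y) w" using between_trans[of u b "J ?y" w] X y JX by simp
      then show ?thesis using X y JX between_sym by (simp add: f'_def FT')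
    qed
    ultimately have "between (f' (F (Suc j))) (f' (T (Suc j))) u" by simp
    then show ?case
      using hom f'X f'H by (intro exI[of _ f']) (auto simp: median_hom_def)
  qed
  from this[of k] obtain f where f: "median_hom (cube k) (cube_median k) X m f"
    and fH: "\<And>e i. e \<in> cube k \<Longrightarrow> i < k \<Longrightarrow> f e \<in> H i \<longleftrightarrow> e i" by auto
  have "inj_on f (cube k)"
  proof (rule inj_onI, rule cube_eqI[of _ k])
    fix x y i assume "x \<in> cube k" "y \<in> cube k" "f x = f y" "i < k"
    then show "x i = y i" using fH[of x i] fH[of y i] by simp
  qed
  then show ?thesis using f by blast
qed

end

text \<open>A shattered family of size \<open>k\<close> embeds the cube of dimension
  \<open>k\<close>, so the rank itself serves as \<open>d\<close>. The rank enters the rest of the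
  proof only through this uniform bound.\<close>

lemma finite_rank_not_shattered:
  fixes X :: "'a set"
  assumes "median_algebra X m" "median_rank X m < \<infinity>"
  shows "\<exists>d. \<forall>(k::nat) H. (\<forall>i<k. H i \<in> halfspaces X m) \<and>
    (\<forall>S\<subseteq>{..<k}. \<exists>x\<in>X. \<forall>i<k. x \<in> H i \<longleftrightarrow> i \<in> S) \<longrightarrow> k \<le> d"
proof -
  obtain d where d: "median_rank X m = enat d" using assms(2) by auto
  show ?thesis
  proof (intro exI[of _ d] allI impI)
    fix k and H :: "nat \<Rightarrow> 'a set"
    assume H: "(\<forall>i<k. H i \<in> halfspaces X m) \<and>
      (\<forall>S\<subseteq>{..<k}. \<exists>x\<in>X. \<forall>i<k. x \<in> H i \<longleftrightarrow> i \<in> S)"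
    have "\<exists>f. inj_on f (cube k) \<and> median_hom (cube k) (cube_median k) X m f"
    proof (rule median_algebra.shattered_cube[OF assms(1)])
      show "median_convex X m (H i) \<and> median_convex X m (X - H i)" if "i < k" for i
        using conjunct1[OF H] that by (simp add: halfspaces_def)
    qed (use conjunct2[OF H] in blast)
    then have "enat k \<le> median_rank X m" unfolding median_rank_def by (intro Sup_upper) blast
    then show "k \<le> d" using d by simp
  qed
qed

section \<open>Sauer-Shelah and Rademacher averages\<close>

definition shatters :: "'b set set \<Rightarrow> 'b set \<Rightarrow> bool"
  where "shatters A T \<longleftrightarrow> (\<forall>S\<subseteq>T. \<exists>Y\<in>A. Y \<inter> T = S)"

lemma inj_on_insert:
  assumes "\<And>Y. Y \<in> A \<Longrightarrow> u \<notin> Y"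
  shows "inj_on (insert u) A"
  using assms by (intro inj_onI) (simp add: insert_ident)

text \<open>Pajor's form of the Sauer--Shelah lemma: delete one point and induct on both the traces and
  the sets that occur with and without that point.\<close>

lemma card_le_card_shattered:
  assumes "finite U" "A \<subseteq> Pow U"
  shows "card A \<le> card {T. T \<subseteq> U \<and> shatters A T}"
  using assms
proof (induction U arbitrary: A rule: finite_induct)
  case empty
  then consider "A = {}" | "A = {{}}" by auto
  then show ?case
  proof cases
    case 2
    then have "{T. T \<subseteq> {} \<and> shatters A T} = {{}}" by (auto simp: shatters_def)
    then show ?thesis using 2 by simp
  qed simp
next
  case (insert u U)
  define A0 where "A0 = {Y \<in> A. u \<notin> Y}"
  define A1 where "A1 = {Y. u \<notin> Y \<and> insert u Y \<in> A}"
  have sub: "A0 \<subseteq> Pow U" "A1 \<subseteq> Pow U" using insert.prems by (auto simp: A0_def A1_def)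
  have fin: "finite A0" "finite A1" using finite_subset[OF sub(1)] finite_subset[OF sub(2)] insert.hyps(1) by simp_all
  have fs: "finite {T. T \<subseteq> U \<and> shatters B T}" for B
    by (rule finite_subset[of _ "Pow U"]) (use insert.hyps(1) in auto)
  have "A = A0 \<union> insert u ` A1"
  proof (intro equalityI subsetI)
    fix Y assume Y: "Y \<in> A"
    show "Y \<in> A0 \<union> insert u ` A1"
    proof (cases "u \<in> Y")
      case True
      then have "insert u (Y - {u}) = Y" by blast
      then have "Y - {u} \<in> A1" "Y = insert u (Y - {u})" using Y by (simp_all add: A1_def)
      then show ?thesis by blast
    qed (use Y in \<open>simp add: A0_def\<close>)
  qed (auto simp: A0_def A1_def)
  moreover have "A0 \<inter> insert u ` A1 = {}" by (auto simp: A0_def)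
  ultimately have "card A = card A0 + card (insert u ` A1)"
    using card_Un_disjoint[of A0 "insert u ` A1"] fin by simp
  also have "card (insert u ` A1) = card A1"
    by (rule card_image, rule inj_on_insert) (simp add: A1_def)
  also have "card A0 + card A1 = card (A0 \<union> A1) + card (A0 \<inter> A1)"
    using fin by (rule card_Un_Int)
  also have "\<dots> \<le> card {T. T \<subseteq> U \<and> shatters (A0 \<union> A1) T} + card {T. T \<subseteq> U \<and> shatters (A0 \<inter> A1) T}"
    using sub by (intro add_mono insert.IH) auto
  also have "\<dots> = card {T. T \<subseteq> U \<and> shatters (A0 \<union> A1) T}
      + card (insert u ` {T. T \<subseteq> U \<and> shatters (A0 \<inter> A1) T})"
  proof (subst card_image)
    show "inj_on (insert u) {T. T \<subseteq> U \<and> shatters (A0 \<inter> A1) T}"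
      by (rule inj_on_insert) (use insert.hyps(2) in auto)
  qed simp
  also have "\<dots> = card ({T. T \<subseteq> U \<and> shatters (A0 \<union> A1) T}
      \<union> insert u ` {T. T \<subseteq> U \<and> shatters (A0 \<inter> A1) T})"
    using insert.hyps fs by (intro card_Un_disjoint[symmetric]) auto
  also have "\<dots> \<le> card {T. T \<subseteq> insert u U \<and> shatters A T}"
  proof (rule card_mono)
    show "finite {T. T \<subseteq> insert u U \<and> shatters A T}" using insert.hyps(1) by simp
    have "shatters A T" if T: "T \<subseteq> U" "shatters (A0 \<union> A1) T" for T
      unfolding shatters_def
    proof (intro allI impI)
      fix S assume "S \<subseteq> T"
      then obtain Y where Y: "Y \<in> A0 \<union> A1" "Y \<inter> T = S" using T unfolding shatters_def by blast
      have "insert u Y \<inter> T = S" using Y T insert.hyps(2) by auto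
      then show "\<exists>Y\<in>A. Y \<inter> T = S" using Y by (auto simp: A0_def A1_def)
    qed
    \<comment> \<open>Every trace on \<open>T\<close> is realised by a set that occurs in
      \<open>A\<close> both with and without \<open>u\<close>, so \<open>u\<close> can be added to
      \<open>T\<close>.\<close>
    moreover have "shatters A (insert u T)" if T: "T \<subseteq> U" "shatters (A0 \<inter> A1) T" for T
      unfolding shatters_def
    proof (intro allI impI)
      fix S assume S: "S \<subseteq> insert u T"
      then have "S - {u} \<subseteq> T" by auto
      then obtain Y where Y: "Y \<in> A0 \<inter> A1" "Y \<inter> T = S - {u}"
        using T unfolding shatters_def by blast
      show "\<exists>Y\<in>A. Y \<inter> insert u T = S"
      proof (cases "u \<in> S")
        case True
        then show ?thesis using Y by (intro bexI[of _ "insert u Y"]) (auto simp: A1_def)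
      next
        case False
        then show ?thesis using Y by (intro bexI[of _ Y]) (auto simp: A0_def)
      qed
    qed
    ultimately show "{T. T \<subseteq> U \<and> shatters (A0 \<union> A1) T}
        \<union> insert u ` {T. T \<subseteq> U \<and> shatters (A0 \<inter> A1) T} \<subseteq> {T. T \<subseteq> insert u U \<and> shatters A T}"
      by auto
  qed
  finally show ?case .
qed

text \<open>Each such set is spelled as a word of length \<open>d\<close> over \<open>{..k}\<close>,
  where the extra letter \<open>k\<close> is padding that the intersection with
  \<open>{..<k}\<close> removes.\<close>

lemma card_small_subsets:
  "card {T. T \<subseteq> {..<k} \<and> card T \<le> d} \<le> (k + 1) ^ d"
proof -
  have "{T. T \<subseteq> {..<k} \<and> card T \<le> d} \<subseteq> (\<lambda>l. set l \<inter> {..<k}) ` {l. set l \<subseteq> {..k} \<and> length l = d}"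
  proof
    fix T assume T: "T \<in> {T. T \<subseteq> {..<k} \<and> card T \<le> d}"
    then have "finite T" using finite_subset by blast
    then obtain l where l: "set l = T" "distinct l" using finite_distinct_list by blast
    then have len: "length l \<le> d" using T distinct_card[of l] by simp
    let ?l = "l @ replicate (d - length l) k"
    have "set ?l \<inter> {..<k} = T" using l T by auto
    moreover have "set ?l \<subseteq> {..k}" using l T by fastforce
    moreover have "length ?l = d" using len by simp
    ultimately show "T \<in> (\<lambda>l. set l \<inter> {..<k}) ` {l. set l \<subseteq> {..k} \<and> length l = d}" by blast
  qed
  then have "card {T. T \<subseteq> {..<k} \<and> card T \<le> d} \<le> card {l. set l \<subseteq> {..k} \<and> length l = d}"
    by (rule surj_card_le[rotated]) (simp add: finite_lists_length_eq)
  also have "\<dots> = (k + 1) ^ d" by (simp add: card_lists_length_eq)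
  finally show ?thesis .
qed

lemma sauer_shelah:
  assumes "A \<subseteq> Pow {..<k::nat}" "\<And>T. T \<subseteq> {..<k} \<Longrightarrow> shatters A T \<Longrightarrow> card T \<le> d"
  shows "card A \<le> (k + 1) ^ d"
proof -
  have "card A \<le> card {T. T \<subseteq> {..<k} \<and> shatters A T}"
    using assms(1) by (intro card_le_card_shattered) auto
  also have "\<dots> \<le> card {T. T \<subseteq> {..<k} \<and> card T \<le> d}"
    using assms(2) by (intro card_mono) auto
  also have "\<dots> \<le> (k + 1) ^ d" by (rule card_small_subsets)
  finally show ?thesis .
qed

section \<open>Exponential moments of Rademacher sums\<close>

abbreviation sign_vectors :: "nat \<Rightarrow> (nat \<Rightarrow> real) set"
  where "sign_vectors k \<equiv> {..<k} \<rightarrow>\<^sub>E {-1, 1}"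

lemma card_sign_vectors: "card (sign_vectors k) = 2 ^ k"
  by (simp add: card_PiE numeral_2_eq_2)

text \<open>A crude substitute for the bound of \<open>cosh t\<close> by
  \<open>exp (t^2 / 2)\<close>; the worse constant is harmless because \<open>t\<close> will be a
  small fixed number.\<close>

lemma exp_le_quadratic:
  fixes t :: real
  assumes "0 \<le> t" "t \<le> 1"
  shows "exp t + exp (- t) \<le> 2 + 2 * t\<^sup>2"
proof -
  have "exp t \<le> 1 + t + t\<^sup>2" using exp_bound assms by simp
  moreover have "exp (- t) \<le> 1 - t + t\<^sup>2"
  proof -
    have "1 + t \<le> exp t" by simp
    then have "exp (- t) \<le> 1 / (1 + t)" using assms by (simp add: exp_minus field_simps)
    also have "\<dots> \<le> 1 - t + t\<^sup>2"
    proof -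
      have "(1 - t + t\<^sup>2) * (1 + t) = 1 + t ^ 3" by (simp add: algebra_simps power3_eq_cube power2_eq_square)
      then show ?thesis using assms by (simp add: divide_le_eq)
    qed
    finally show ?thesis .
  qed
  ultimately show ?thesis by simp
qed

text \<open>Independence of the signs turns the sum into a product over the coordinates. A
  coordinate with \<open>p i = 0\<close> contributes \<open>2\<close>, one with
  \<open>p i = 1\<close> contributes \<open>exp t + exp (- t)\<close>, and both are at most
  \<open>2 * exp (t^2)\<close>.\<close>

lemma sum_exp_signs_le:
  assumes p: "\<And>i. i < k \<Longrightarrow> p i \<in> {0, 1::real}" and t: "\<bar>t\<bar> \<le> (1::real)"
  shows "(\<Sum>e\<in>sign_vectors k. exp (t * (\<Sum>i<k. e i * p i))) \<le> 2 ^ k * exp (real k * t\<^sup>2)"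
proof -
  have "(\<Sum>e\<in>sign_vectors k. exp (t * (\<Sum>i<k. e i * p i)))
      = (\<Sum>e\<in>sign_vectors k. \<Prod>i<k. exp (t * (e i * p i)))"
    by (simp add: exp_sum sum_distrib_left)
  also have "\<dots> = (\<Prod>i<k. \<Sum>s\<in>{-1, 1}. exp (t * (s * p i)))"
    by (subst prod_sum_PiE) auto
  also have "\<dots> \<le> (\<Prod>i<k. 2 * exp (t\<^sup>2))"
  proof (intro prod_mono conjI)
    fix i assume i: "i \<in> {..<k}"
    have "exp t + exp (- t) \<le> 2 + 2 * t\<^sup>2"
      using exp_le_quadratic[of "\<bar>t\<bar>"] t by (cases "t \<ge> 0") auto
    also have "\<dots> \<le> 2 * exp (t\<^sup>2)" using exp_ge_add_one_self[of "t\<^sup>2"] by linarith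
    finally show "(\<Sum>s\<in>{-1, 1}. exp (t * (s * p i))) \<le> 2 * exp (t\<^sup>2)"
      using p[of i] i by auto
  qed (auto intro: sum_nonneg)
  also have "\<dots> = 2 ^ k * exp (real k * t\<^sup>2)"
    by (simp add: power_mult_distrib exp_of_nat_mult)
  finally show ?thesis .
qed

text \<open>The maximal inequality for Rademacher averages over \<open>n\<close> patterns, with \<open>x e\<close> the index at
  which the maximum for the signs \<open>e\<close> is attained.\<close>

lemma rademacher_patterns:
  fixes p :: "'x \<Rightarrow> nat \<Rightarrow> real" and t :: real
  assumes p: "\<And>x i. i < k \<Longrightarrow> p x i \<in> {0, 1}"
    and card: "card ((\<lambda>x. restrict (p x) {..<k}) ` UNIV) \<le> n" and n: "0 < n"
    and t: "0 < t" "t \<le> 1"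
  shows "(\<Sum>e\<in>sign_vectors k. \<bar>\<Sum>i<k. e i * p (x e) i\<bar>) \<le> 2 ^ k * ((ln (2 * real n)) / t + real k * t)"
proof -
  define P where "P = (\<lambda>x. restrict (p x) {..<k}) ` UNIV"
  have "P \<subseteq> {..<k} \<rightarrow>\<^sub>E {0, 1}" unfolding P_def image_subset_iff using p by simp
  then have fin: "finite P" by (rule finite_subset) (auto intro: finite_PiE)
  define S where "S e = (\<Sum>i<k. e i * p (x e) i)" for e
  \<comment> \<open>\<open>exp c\<close> will bound the mean of
    \<open>exp (t * \<bar>S e\<bar>)\<close>; the factor \<open>2 * n\<close> in it counts
    \<open>n\<close> patterns with both signs, since the selected pattern is dominated by the sum
    over all of them.\<close>
  define c where "c = ln (2 * real n) + real k * t\<^sup>2"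
  have pt: "exp (t * \<bar>S e\<bar>) \<le> (\<Sum>q\<in>P. exp (t * (\<Sum>i<k. e i * q i)) + exp (- t * (\<Sum>i<k. e i * q i)))" for e
  proof -
    let ?q = "restrict (p (x e)) {..<k}"
    have S: "S e = (\<Sum>i<k. e i * ?q i)" by (simp add: S_def)
    have "exp (t * \<bar>S e\<bar>) \<le> exp (t * S e) + exp (- t * S e)" by (cases "S e \<ge> 0") auto
    also have "\<dots> \<le> (\<Sum>q\<in>P. exp (t * (\<Sum>i<k. e i * q i)) + exp (- t * (\<Sum>i<k. e i * q i)))"
      unfolding S
    proof (rule member_le_sum)
      show "?q \<in> P" unfolding P_def by (rule rangeI)
    qed (use fin in \<open>auto simp: add_nonneg_nonneg\<close>)
    finally show ?thesis .
  qed
  have q: "q i \<in> {0, 1}" if "q \<in> P" "i < k" for q i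
  proof -
    obtain x where "q = restrict (p x) {..<k}" using \<open>q \<in> P\<close> unfolding P_def by blast
    then show ?thesis using p[of i x] \<open>i < k\<close> by simp
  qed
  have "(\<Sum>e\<in>sign_vectors k. exp (t * \<bar>S e\<bar>))
      \<le> (\<Sum>e\<in>sign_vectors k. \<Sum>q\<in>P. exp (t * (\<Sum>i<k. e i * q i)) + exp (- t * (\<Sum>i<k. e i * q i)))"
    by (intro sum_mono pt)
  also have "\<dots> = (\<Sum>q\<in>P. (\<Sum>e\<in>sign_vectors k. exp (t * (\<Sum>i<k. e i * q i)))
      + (\<Sum>e\<in>sign_vectors k. exp (- t * (\<Sum>i<k. e i * q i))))"
    by (subst sum.swap) (simp add: sum.distrib)
  also have "\<dots> \<le> (\<Sum>q\<in>P. 2 ^ k * exp (real k * t\<^sup>2) + 2 ^ k * exp (real k * (- t)\<^sup>2))"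
    by (intro sum_mono add_mono sum_exp_signs_le q) (use t in auto)
  also have "\<dots> = real (card P) * (2 * (2 ^ k * exp (real k * t\<^sup>2)))" by simp
  also have "\<dots> \<le> real n * (2 * (2 ^ k * exp (real k * t\<^sup>2)))"
    using card by (intro mult_right_mono) (auto simp: P_def)
  also have "\<dots> = 2 ^ k * exp c" using n by (simp add: c_def exp_add)
  finally have exp: "(\<Sum>e\<in>sign_vectors k. exp (t * \<bar>S e\<bar>)) \<le> 2 ^ k * exp c" .
  \<comment> \<open>The tangent of \<open>exp\<close> at \<open>c\<close> replaces Jensen's
    inequality in passing from the exponential moment to the mean.\<close>
  have tangent: "t * \<bar>S e\<bar> \<le> exp (- c) * exp (t * \<bar>S e\<bar>) + (c - 1)" for e
    using exp_ge_add_one_self[of "t * \<bar>S e\<bar> - c"] by (simp add: exp_diff exp_minus field_simps)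
  have "t * (\<Sum>e\<in>sign_vectors k. \<bar>S e\<bar>) \<le> (\<Sum>e\<in>sign_vectors k. exp (- c) * exp (t * \<bar>S e\<bar>) + (c - 1))"
    unfolding sum_distrib_left by (intro sum_mono tangent)
  also have "\<dots> = exp (- c) * (\<Sum>e\<in>sign_vectors k. exp (t * \<bar>S e\<bar>)) + 2 ^ k * (c - 1)"
    by (simp add: sum.distrib sum_distrib_left card_sign_vectors)
  also have "\<dots> \<le> exp (- c) * (2 ^ k * exp c) + 2 ^ k * (c - 1)"
    using exp by simp
  also have "\<dots> = 2 ^ k * c" by (simp add: exp_minus field_simps)
  finally show ?thesis
    using t by (simp add: S_def c_def field_simps power2_eq_square)
qed

text \<open>As \<open>x\<close> ranges over all selections, this bounds the average over the signs of the supremum norm of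
  \<open>\<Sum>i<k. e i * f i\<close>, without mentioning suprema.\<close>

definition rademacher_small :: "('x \<Rightarrow> real) set \<Rightarrow> bool"
  where "rademacher_small F \<longleftrightarrow> (\<forall>\<delta>>0. \<exists>k>0. \<forall>f x. (\<forall>i<k. f i \<in> F) \<longrightarrow>
    (\<Sum>e\<in>sign_vectors k. \<bar>\<Sum>i<k. e i * f i (x e)\<bar>) \<le> 2 ^ k * (\<delta> * real k))"

lemma polynomial_growth_rademacher_small:
  fixes F :: "('x \<Rightarrow> real) set"
  assumes F: "\<And>f x. f \<in> F \<Longrightarrow> f x \<in> {0, 1}"
    and card: "\<And>k f. \<lbrakk>\<And>i. i < k \<Longrightarrow> f i \<in> F\<rbrakk> \<Longrightarrow>
      card ((\<lambda>x. \<lambda>i\<in>{..<k}. f i x) ` UNIV) \<le> (k + 1) ^ d"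
  shows "rademacher_small F"
  unfolding rademacher_small_def
proof (intro allI impI)
  fix \<delta> :: real assume \<delta>: "\<delta> > 0"
  \<comment> \<open>This makes \<open>real k * t\<close> at most half of the target. The logarithm
    of the polynomial pattern count is \<open>o(k)\<close>, so for large \<open>k\<close> the other
    term fits into the other half. The cap \<open>1\<close> is the range of the quadratic bound on
    \<open>exp\<close>.\<close>
  define t where "t = min 1 (\<delta> / 2)"
  have t: "0 < t" "t \<le> 1" "t \<le> \<delta> / 2" using \<delta> by (auto simp: t_def)
  have "((\<lambda>k. ln (2 * (real k + 1) ^ d) / real k) \<longlongrightarrow> 0) sequentially"
    by real_asymp
  then have "\<forall>\<^sub>F k in sequentially. ln (2 * (real k + 1) ^ d) / real k < t * (\<delta> / 2)"
    by (rule order_tendstoD) (use t \<delta> in simp)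
  then have "\<forall>\<^sub>F k in sequentially. ln (2 * (real k + 1) ^ d) / real k < t * (\<delta> / 2) \<and> k > 0"
    using eventually_gt_at_top by (rule eventually_conj)
  then obtain k :: nat where k: "ln (2 * (real k + 1) ^ d) / real k < t * (\<delta> / 2)" "k > 0"
    using eventually_happens by force
  have le: "ln (2 * real ((k + 1) ^ d)) / t + real k * t \<le> \<delta> * real k"
  proof -
    have "ln (2 * real ((k + 1) ^ d)) / t \<le> \<delta> / 2 * real k"
      using k t by (simp add: field_simps)
    moreover have "real k * t \<le> \<delta> / 2 * real k" using mult_right_mono[OF t(3), of "real k"] by (simp add: mult.commute)
    ultimately show ?thesis by (simp add: field_simps)
  qed
  show "\<exists>k>0. \<forall>f x. (\<forall>i<k. f i \<in> F) \<longrightarrow>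
    (\<Sum>e\<in>sign_vectors k. \<bar>\<Sum>i<k. e i * f i (x e)\<bar>) \<le> 2 ^ k * (\<delta> * real k)"
  proof (intro exI[of _ k] conjI allI impI k(2))
    fix f :: "nat \<Rightarrow> 'x \<Rightarrow> real" and x assume f: "\<forall>i<k. f i \<in> F"
    have "(\<Sum>e\<in>sign_vectors k. \<bar>\<Sum>i<k. e i * f i (x e)\<bar>)
        \<le> 2 ^ k * (ln (2 * real ((k + 1) ^ d)) / t + real k * t)"
      using f F card[of k f] t by (intro rademacher_patterns) auto
    also have "\<dots> \<le> 2 ^ k * (\<delta> * real k)" using le by simp
    finally show "(\<Sum>e\<in>sign_vectors k. \<bar>\<Sum>i<k. e i * f i (x e)\<bar>) \<le> 2 ^ k * (\<delta> * real k)" .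
  qed
qed

text \<open>The average is convex and even in each \<open>f i\<close> separately, so the bound passes to the hull one
  coordinate at a time.\<close>

lemma rademacher_small_hull:
  assumes "rademacher_small F"
  shows "rademacher_small (convex hull (insert 0 (F \<union> uminus ` F)))"
  unfolding rademacher_small_def
proof (intro allI impI)
  define W where "W = convex hull (insert 0 (F \<union> uminus ` F))"
  fix \<delta> :: real assume \<delta>: "\<delta> > 0"
  then obtain k where k: "k > 0" "\<And>f x. (\<forall>i<k. f i \<in> F) \<Longrightarrow>
      (\<Sum>e\<in>sign_vectors k. \<bar>\<Sum>i<k. e i * f i (x e)\<bar>) \<le> 2 ^ k * (\<delta> * real k)"
    using assms unfolding rademacher_small_def by meson
  have "\<exists>k>0. \<forall>f x. (\<forall>i<k. f i \<in> W) \<longrightarrow>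
    (\<Sum>e\<in>sign_vectors k. \<bar>\<Sum>i<k. e i * f i (x e)\<bar>) \<le> 2 ^ k * (\<delta> * real k)"
  proof (cases "F = {}")
    case True
    then have "W = {0}" by (simp add: W_def)
    then show ?thesis using k(1) \<delta> by (intro exI[of _ k]) auto
  next
    case False
    let ?\<Phi> = "\<lambda>x f. \<Sum>e\<in>sign_vectors k. \<bar>\<Sum>i<k. e i * f i (x e)\<bar>" and ?B = "2 ^ k * (\<delta> * real k)"
    have *: "\<forall>x. ?\<Phi> x f \<le> ?B"
      if "j \<le> k" "\<forall>i<j. f i \<in> W" "\<forall>i. j \<le> i \<and> i < k \<longrightarrow> f i \<in> F" for f :: "nat \<Rightarrow> 'a \<Rightarrow> real" and j
      using that
    proof (induction j arbitrary: f)
      case 0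
      then show ?case using k(2) by simp
    next
      case (Suc j)
      \<comment> \<open>The admissible replacements of entry \<open>j\<close>, for all selections at
        once: the sign flip that makes \<open>T\<close> symmetric also changes the
        selection.\<close>
      define T where "T = {w. \<forall>x. ?\<Phi> x (f(j := w)) \<le> ?B}"
      have "F \<subseteq> T"
      proof
        fix w assume "w \<in> F"
        then have "\<forall>x. ?\<Phi> x (f(j := w)) \<le> ?B"
          using Suc.prems by (intro Suc.IH) auto
        then show "w \<in> T" unfolding T_def by blast
      qed
      moreover have "- w \<in> T" if w: "w \<in> T" for w
      proof -
        let ?\<phi> = "\<lambda>e :: nat \<Rightarrow> real. e(j := - e j)"
        have "?\<Phi> x (f(j := - w)) = ?\<Phi> (\<lambda>e. x (?\<phi> e)) (f(j := w))" for x
        proof (rule sum.reindex_bij_witness[of _ ?\<phi> ?\<phi>])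
          fix e :: "nat \<Rightarrow> real" assume "e \<in> sign_vectors k"
          then show "?\<phi> e \<in> sign_vectors k" "?\<phi> e \<in> sign_vectors k" using Suc.prems(1)
            by (auto simp: PiE_iff extensional_def)
          have "(\<Sum>i<k. ?\<phi> e i * (f(j := w)) i (x (?\<phi> (?\<phi> e)))) = (\<Sum>i<k. e i * (f(j := - w)) i (x e))"
            by (intro sum.cong) auto
          then show "\<bar>\<Sum>i<k. ?\<phi> e i * (f(j := w)) i (x (?\<phi> (?\<phi> e)))\<bar> = \<bar>\<Sum>i<k. e i * (f(j := - w)) i (x e)\<bar>"
            by simp
        qed auto
        then show ?thesis using w by (simp only: T_def mem_Collect_eq) blast
      qed
      moreover have "convex T"
      proof (rule convexI)
        fix a b u v assume ab: "a \<in> T" "b \<in> T" and uv: "0 \<le> u" "0 \<le> v" "u + v = (1::real)"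
        have "?\<Phi> x (f(j := u *\<^sub>R a + v *\<^sub>R b)) \<le> ?B" for x
        proof -
          let ?S = "\<lambda>w e. \<Sum>i<k. e i * (f(j := w)) i (x e)"
          have S: "?S (u *\<^sub>R a + v *\<^sub>R b) e = u * ?S a e + v * ?S b e" for e
          proof -
            have "u * y + v * y = y" for y using uv(3) by (metis distrib_right mult_1)
            then show ?thesis
              unfolding sum_distrib_left sum.distrib[symmetric]
              by (intro sum.cong) (auto simp: scaleR_fun_def distrib_left mult.left_commute)
          qed
          have "?\<Phi> x (f(j := u *\<^sub>R a + v *\<^sub>R b)) \<le> (\<Sum>e\<in>sign_vectors k. u * \<bar>?S a e\<bar> + v * \<bar>?S b e\<bar>)"
            unfolding S
          proof (rule sum_mono)
            fix e
            have "\<bar>u * ?S a e + v * ?S b e\<bar> \<le> \<bar>u * ?S a e\<bar> + \<bar>v * ?S b e\<bar>" by (rule abs_triangle_ineq)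
            then show "\<bar>u * ?S a e + v * ?S b e\<bar> \<le> u * \<bar>?S a e\<bar> + v * \<bar>?S b e\<bar>"
              using uv by (simp add: abs_mult)
          qed
          also have "\<dots> = u * ?\<Phi> x (f(j := a)) + v * ?\<Phi> x (f(j := b))"
            by (simp add: sum.distrib sum_distrib_left)
          also have "\<dots> \<le> u * ?B + v * ?B"
            using ab uv unfolding T_def by (intro add_mono mult_left_mono) auto
          also have "\<dots> = ?B" using uv(3) by (metis distrib_right mult_1)
          finally show ?thesis .
        qed
        then show "u *\<^sub>R a + v *\<^sub>R b \<in> T" by (simp add: T_def)
      qed
      moreover have "0 \<in> T"
      proof -
        \<comment> \<open>\<open>0\<close> is the midpoint of \<open>w\<close> and
          \<open>- w\<close>; empty \<open>F\<close> was split off to have such a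
          \<open>w\<close>.\<close>
        obtain w where w: "w \<in> F" using False by blast
        have "(1 / 2) *\<^sub>R w + (1 / 2) *\<^sub>R (- w) \<in> T"
          using w calculation by (intro convexD) auto
        then show ?thesis by simp
      qed
      ultimately have "W \<subseteq> T" unfolding W_def by (intro hull_minimal) auto
      then have "f j \<in> T" using Suc.prems by auto
      then show ?case unfolding T_def mem_Collect_eq fun_upd_triv .
    qed
    have "\<forall>x. ?\<Phi> x f \<le> ?B" if "\<forall>i<k. f i \<in> W" for f
      by (rule *[OF order_refl that]) auto
    then show ?thesis using k(1) by blast
  qed
  then show "\<exists>k>0. \<forall>f x. (\<forall>i<k. f i \<in> convex hull (insert 0 (F \<union> uminus ` F))) \<longrightarrow>
    (\<Sum>e\<in>sign_vectors k. \<bar>\<Sum>i<k. e i * f i (x e)\<bar>) \<le> 2 ^ k * (\<delta> * real k)"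
    unfolding W_def .
qed

section \<open>Interpolation spaces without \<open>\<ell>\<^sub>1\<close>\<close>

definition comb :: "nat set \<Rightarrow> (nat \<Rightarrow> real) \<Rightarrow> nat \<Rightarrow> real"
  where "comb I c = (\<lambda>n. if n \<in> I then c n else 0)"

abbreviation unit_seq :: "nat \<Rightarrow> nat \<Rightarrow> real"
  where "unit_seq i \<equiv> comb {i} (\<lambda>_. 1)"

lemma comb_ell1:
  assumes "finite I"
  shows "comb I c \<in> ell1" "ell1_norm (comb I c) = (\<Sum>i\<in>I. \<bar>c i\<bar>)"
proof -
  have 0: "\<bar>comb I c n\<bar> = 0" if "n \<notin> I" for n using that by (simp add: comb_def)
  show "comb I c \<in> ell1" unfolding ell1_def using summable_finite[OF assms 0] by simp
  show "ell1_norm (comb I c) = (\<Sum>i\<in>I. \<bar>c i\<bar>)"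
    unfolding ell1_norm_def using suminf_finite[OF assms 0] by (simp add: comb_def)
qed

lemma ell1_scale: "a \<in> ell1 \<Longrightarrow> c *\<^sub>R a \<in> ell1"
  by (simp add: ell1_def scaleR_fun_def abs_mult summable_mult)

lemma linear_comb:
  assumes T: "linear_map_on ell1 T" and "finite I"
  shows "T (comb I c) = (\<Sum>i\<in>I. c i *\<^sub>R T (unit_seq i))"
  using assms(2)
proof (induction I rule: finite_induct)
  case empty
  have "T (0 *\<^sub>R comb {} c) = 0 *\<^sub>R T (comb {} c)"
    using T comb_ell1(1)[of "{}"] unfolding linear_map_on_def by blast
  moreover have "0 *\<^sub>R comb {} c = comb {} c" by (simp add: comb_def scaleR_fun_def)
  ultimately show ?case by (simp only: scale_zero_left sum.empty)
next
  case (insert i I)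
  have "comb (insert i I) c = comb I c + c i *\<^sub>R unit_seq i"
    using insert.hyps by (auto simp: comb_def fun_eq_iff scaleR_fun_def)
  then have "T (comb (insert i I) c) = T (comb I c) + T (c i *\<^sub>R unit_seq i)"
    using T comb_ell1(1)[OF insert.hyps(1), of c] ell1_scale[OF comb_ell1(1)[of "{i}"]]
    by (simp add: linear_map_on_def)
  also have "T (c i *\<^sub>R unit_seq i) = c i *\<^sub>R T (unit_seq i)"
    using T comb_ell1(1)[of "{i}"] by (simp add: linear_map_on_def)
  finally show ?case using insert by (simp add: add.commute)
qed

lemma sum_scaleR_fun_apply:
  fixes f :: "'i \<Rightarrow> 'x \<Rightarrow> real"
  shows "(\<Sum>i\<in>I. c i *\<^sub>R f i) x = (\<Sum>i\<in>I. c i * f i x)"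
  by (induction I rule: infinite_finite_induct) (simp_all add: scaleR_fun_def)

text \<open>If every sign vector failed at some point, choosing one such point for each would give a
  selection that violates the averaged bound.\<close>

lemma rademacher_small_signs:
  fixes W :: "('x \<Rightarrow> real) set"
  assumes "rademacher_small W" "\<delta> > 0"
  shows "\<exists>k>0. \<forall>w. (\<forall>i<k. w i \<in> W) \<longrightarrow>
    (\<exists>e\<in>sign_vectors k. \<forall>x. \<bar>\<Sum>i<k. e i * w i x\<bar> \<le> \<delta> * real k)"
proof -
  obtain k where k: "k > 0" "\<And>f x. (\<forall>i<k. f i \<in> W) \<Longrightarrow>
      (\<Sum>e\<in>sign_vectors k. \<bar>\<Sum>i<k. e i * f i (x e)\<bar>) \<le> 2 ^ k * (\<delta> * real k)"
    using assms unfolding rademacher_small_def by meson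
  have "\<exists>e\<in>sign_vectors k. \<forall>x. \<bar>\<Sum>i<k. e i * w i x\<bar> \<le> \<delta> * real k"
    if w: "\<forall>i<k. w i \<in> W" for w
  proof (rule ccontr)
    assume "\<not> ?thesis"
    then have "\<forall>e\<in>sign_vectors k. \<exists>x. \<delta> * real k < \<bar>\<Sum>i<k. e i * w i x\<bar>"
      by (meson not_le)
    then obtain x where x: "\<forall>e\<in>sign_vectors k. \<delta> * real k < \<bar>\<Sum>i<k. e i * w i (x e)\<bar>"
      by metis
    have "2 ^ k * (\<delta> * real k) = (\<Sum>e\<in>sign_vectors k. \<delta> * real k)"
      by (simp add: card_sign_vectors)
    also have "\<dots> < (\<Sum>e\<in>sign_vectors k. \<bar>\<Sum>i<k. e i * w i (x e)\<bar>)"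
    proof (rule sum_strict_mono)
      show "finite (sign_vectors k)" by (simp add: finite_PiE)
      show "sign_vectors k \<noteq> {}" by (simp add: PiE_eq_empty_iff)
    qed (use x in blast)
    finally show False using k(2)[of w x] w by simp
  qed
  then show ?thesis using k(1) by blast
qed

definition bounded_funs :: "('x \<Rightarrow> real) set"
  where "bounded_funs = {v. \<exists>B. \<forall>x. \<bar>v x\<bar> \<le> B}"

lemma bounded_funsE:
  assumes "v \<in> bounded_funs"
  obtains B where "0 < B" "\<And>x. \<bar>v x\<bar> \<le> B"
proof -
  obtain B where B: "\<And>x. \<bar>v x\<bar> \<le> B" using assms unfolding bounded_funs_def by blast
  have "\<bar>v x\<bar> \<le> max B 1" for x using B[of x] by simp
  then show ?thesis using that[of "max B 1"] by simp
qed

lemma bounded_funsI: "(\<And>x. \<bar>v x\<bar> \<le> B) \<Longrightarrow> v \<in> bounded_funs"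
  unfolding bounded_funs_def by blast

lemma bounded_funs_add:
  assumes "u \<in> bounded_funs" "v \<in> bounded_funs"
  shows "u + v \<in> bounded_funs"
proof -
  obtain B C where "\<And>x. \<bar>u x\<bar> \<le> B" "\<And>x. \<bar>v x\<bar> \<le> C" using assms bounded_funsE by metis
  then have "\<bar>(u + v) x\<bar> \<le> B + C" for x
    using abs_triangle_ineq[of "u x" "v x"] add_mono[of "\<bar>u x\<bar>" B "\<bar>v x\<bar>" C] by fastforce
  then show ?thesis by (rule bounded_funsI)
qed

lemma bounded_funs_scale:
  assumes "v \<in> bounded_funs"
  shows "c *\<^sub>R v \<in> bounded_funs"
proof -
  obtain B where "\<And>x. \<bar>v x\<bar> \<le> B" using assms bounded_funsE by metis
  then have "\<bar>(c *\<^sub>R v) x\<bar> \<le> \<bar>c\<bar> * B" for x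
    by (simp add: scaleR_fun_def abs_mult mult_left_mono)
  then show ?thesis by (rule bounded_funsI)
qed

lemma bounded_funs_diff: "\<lbrakk>u \<in> bounded_funs; v \<in> bounded_funs\<rbrakk> \<Longrightarrow> u - v \<in> bounded_funs"
  using bounded_funs_add[of u "(-1) *\<^sub>R v"] bounded_funs_scale[of v "-1"] by simp

text \<open>The interpolation construction of Davis, Figiel, Johnson and Pelczynski: the gauge at
  level \<open>n\<close> is the Minkowski functional of \<open>2\<^sup>n W\<close> thickened by a ball of radius \<open>2\<^sup>-\<^sup>n\<close> in the
  supremum norm.  The gauges are combined in a \<open>c\<^sub>0\<close>-sum instead of the customary \<open>\<ell>\<^sub>2\<close>-sum.\<close>

locale interpolation =
  fixes F :: "('x \<Rightarrow> real) set"
  assumes F_bound: "\<And>f x. f \<in> F \<Longrightarrow> \<bar>f x\<bar> \<le> 1"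
begin

text \<open>Inserting \<open>0\<close> keeps \<open>W\<close> nonempty even for empty
  \<open>F\<close>.\<close>

definition W :: "('x \<Rightarrow> real) set"
  where "W = convex hull (insert 0 (F \<union> uminus ` F))"

text \<open>The factors \<open>r\<close> with \<open>v\<close> in \<open>r (2^n W + 2^-n B)\<close>,
  where \<open>B\<close> is the closed unit ball of the supremum norm, written pointwise to avoid
  suprema.\<close>

definition scales :: "nat \<Rightarrow> ('x \<Rightarrow> real) \<Rightarrow> real set"
  where "scales n v = {r. 0 < r \<and> (\<exists>w\<in>W. \<forall>x. \<bar>v x - r * (2 ^ n * w x)\<bar> \<le> r / 2 ^ n)}"

definition layer_gauge :: "nat \<Rightarrow> ('x \<Rightarrow> real) \<Rightarrow> real"
  where "layer_gauge n v = Inf (scales n v)"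

text \<open>Boundedness makes every \<open>scales n v\<close> nonempty, so that \<open>Inf\<close>
  in \<open>layer_gauge\<close> is meaningful.\<close>

definition V :: "('x \<Rightarrow> real) set"
  where "V = {v \<in> bounded_funs. (\<lambda>n. layer_gauge n v) \<longlonglongrightarrow> 0}"

definition N :: "('x \<Rightarrow> real) \<Rightarrow> real"
  where "N v = (SUP n. layer_gauge n v)"

lemma convex_W: "convex W"
  by (simp add: W_def convex_convex_hull)

lemma W_gen: "0 \<in> W" "f \<in> F \<Longrightarrow> f \<in> W"
  by (simp_all add: W_def hull_inc)

lemma W_induct:
  assumes "convex P" "0 \<in> P" "\<And>f. f \<in> F \<Longrightarrow> f \<in> P" "\<And>f. f \<in> F \<Longrightarrow> - f \<in> P"
  shows "W \<subseteq> P"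
  unfolding W_def using assms by (intro hull_minimal) auto

lemma W_uminus: "w \<in> W \<Longrightarrow> - w \<in> W"
proof -
  have "W \<subseteq> {w. - w \<in> W}"
  proof (rule W_induct)
    show "convex {w. - w \<in> W}"
    proof (rule convexI)
      fix a b u v assume "a \<in> {w. - w \<in> W}" "b \<in> {w. - w \<in> W}" "0 \<le> u" "0 \<le> v" "u + v = (1::real)"
      then have "u *\<^sub>R (- a) + v *\<^sub>R (- b) \<in> W" using convex_W by (intro convexD) simp_all
      then show "u *\<^sub>R a + v *\<^sub>R b \<in> {w. - w \<in> W}" by simp
    qed
    show "0 \<in> {w. - w \<in> W}" using W_gen by simp
    show "f \<in> {w. - w \<in> W}" "- f \<in> {w. - w \<in> W}" if "f \<in> F" for f
      using that W_gen by (simp_all add: W_def hull_inc)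
  qed
  then show "w \<in> W \<Longrightarrow> - w \<in> W" by blast
qed

lemma W_scale:
  assumes "w \<in> W" "0 \<le> c" "c \<le> 1"
  shows "c *\<^sub>R w \<in> W"
  using convexD[OF convex_W assms(1) W_gen(1), of c "1 - c"] assms by simp

lemma W_bound:
  assumes "w \<in> W"
  shows "\<bar>w x\<bar> \<le> 1"
proof -
  have "W \<subseteq> {w. \<bar>w x\<bar> \<le> 1}"
  proof (rule W_induct)
    show "convex {w :: 'x \<Rightarrow> real. \<bar>w x\<bar> \<le> 1}"
    proof (rule convexI)
      fix a b :: "'x \<Rightarrow> real" and u v assume *: "a \<in> {w. \<bar>w x\<bar> \<le> 1}" "b \<in> {w. \<bar>w x\<bar> \<le> 1}" "0 \<le> u" "0 \<le> v" "u + v = (1::real)"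
      have "\<bar>u * a x + v * b x\<bar> \<le> u * \<bar>a x\<bar> + v * \<bar>b x\<bar>"
        using * abs_triangle_ineq[of "u * a x" "v * b x"] by (simp add: abs_mult)
      also have "\<dots> \<le> u * 1 + v * 1" using * by (intro add_mono mult_left_mono) auto
      finally show "u *\<^sub>R a + v *\<^sub>R b \<in> {w. \<bar>w x\<bar> \<le> 1}" using * by (simp add: scaleR_fun_def)
    qed
  qed (use F_bound in auto)
  then show ?thesis using assms by blast
qed

section \<open>The gauge of a single level is a seminorm comparable to the supremum norm\<close>

lemma scalesI:
  "\<lbrakk>0 < r; w \<in> W; \<And>x. \<bar>v x - r * (2 ^ n * w x)\<bar> \<le> r / 2 ^ n\<rbrakk> \<Longrightarrow> r \<in> scales n v"
  unfolding scales_def by blast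

lemma scalesE:
  assumes "r \<in> scales n v"
  obtains w where "0 < r" "w \<in> W" "\<And>x. \<bar>v x - r * (2 ^ n * w x)\<bar> \<le> r / 2 ^ n"
  using assms unfolding scales_def by blast

lemma scales_bound:
  assumes "0 < B" "\<And>x. \<bar>v x\<bar> \<le> B"
  shows "2 ^ n * B \<in> scales n v"
  by (rule scalesI[OF _ W_gen(1)]) (use assms in auto)

lemma scales_nonempty: "v \<in> bounded_funs \<Longrightarrow> scales n v \<noteq> {}"
  using scales_bound bounded_funsE by (metis empty_iff)

lemma scales_bdd: "bdd_below (scales n v)"
  by (rule bdd_belowI[of _ 0]) (auto simp: scales_def)

lemma gauge_le: "r \<in> scales n v \<Longrightarrow> layer_gauge n v \<le> r"
  unfolding layer_gauge_def using scales_bdd by (rule cInf_lower[rotated])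

lemma gauge_nonneg: "v \<in> bounded_funs \<Longrightarrow> 0 \<le> layer_gauge n v"
  unfolding layer_gauge_def using scales_nonempty by (rule cInf_greatest) (auto simp: scales_def)

text \<open>\<open>W\<close> is star-shaped about \<open>0\<close>, so \<open>scales n v\<close> is
  upward closed. The infimum need not be attained, whence the strict inequality.\<close>

lemma scales_gt:
  assumes "v \<in> bounded_funs" "layer_gauge n v < r"
  shows "r \<in> scales n v"
proof -
  obtain s where s: "s \<in> scales n v" "s < r"
    using assms cInf_lessD[OF scales_nonempty] unfolding layer_gauge_def by blast
  then obtain w where w: "0 < s" "w \<in> W" "\<And>x. \<bar>v x - s * (2 ^ n * w x)\<bar> \<le> s / 2 ^ n"
    using scalesE by metis
  show ?thesis
  proof (rule scalesI)
    show "0 < r" using w s by simp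
    then show "(s / r) *\<^sub>R w \<in> W" using w s by (intro W_scale) auto
    have "s / 2 ^ n \<le> r / 2 ^ n" using s by (simp add: divide_right_mono)
    then show "\<bar>v x - r * (2 ^ n * ((s / r) *\<^sub>R w) x)\<bar> \<le> r / 2 ^ n" for x
      using w(3)[of x] \<open>0 < r\<close> by (simp add: scaleR_fun_def mult.left_commute)
  qed
qed

lemma gauge_leI:
  assumes "v \<in> bounded_funs" "\<And>s. r < s \<Longrightarrow> s \<in> scales n v"
  shows "layer_gauge n v \<le> r"
  by (rule field_le_epsilon) (use assms gauge_le in auto)

text \<open>Choosing \<open>0\<close> as the element of \<open>W\<close> leaves only the ball.
  Uniformly small functions thus have small gauge at each fixed level, but this estimate is not
  uniform in the level.\<close>

lemma gauge_sup:
  assumes "0 \<le> B" "\<And>x. \<bar>v x\<bar> \<le> B"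
  shows "layer_gauge n v \<le> 2 ^ n * B"
proof (rule gauge_leI)
  fix s assume s: "2 ^ n * B < s"
  then have "B < s / 2 ^ n" by (simp add: field_simps)
  then have "2 ^ n * (s / 2 ^ n) \<in> scales n v"
    using assms by (intro scales_bound) (auto intro: order_trans less_imp_le)
  then show "s \<in> scales n v" by simp
qed (use assms in \<open>auto intro: bounded_funsI\<close>)

lemma gauge_add:
  assumes "u \<in> bounded_funs" "v \<in> bounded_funs"
  shows "layer_gauge n (u + v) \<le> layer_gauge n u + layer_gauge n v"
proof (rule field_le_epsilon)
  fix e :: real assume "0 < e"
  define r where "r = layer_gauge n u + e / 2"
  define s where "s = layer_gauge n v + e / 2"
  have "r \<in> scales n u" "s \<in> scales n v"
    using scales_gt assms \<open>0 < e\<close> by (auto simp: r_def s_def)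
  then obtain a b where ab: "0 < r" "0 < s" "a \<in> W" "b \<in> W"
    "\<And>x. \<bar>u x - r * (2 ^ n * a x)\<bar> \<le> r / 2 ^ n" "\<And>x. \<bar>v x - s * (2 ^ n * b x)\<bar> \<le> s / 2 ^ n"
    by (metis scalesE)
  let ?w = "(r / (r + s)) *\<^sub>R a + (s / (r + s)) *\<^sub>R b"
  have "r + s \<in> scales n (u + v)"
  proof (rule scalesI)
    show "?w \<in> W"
      using ab by (intro convexD[OF convex_W]) (auto simp: add_divide_distrib[symmetric])
    fix x
    have "(r + s) * ?w x = r * a x + s * b x"
    proof -
      have "(r + s) * (r / (r + s)) = r" "(r + s) * (s / (r + s)) = s" using ab by simp_all
      then show ?thesis by (simp only: scaleR_fun_def plus_fun_apply real_scaleR_def distrib_left mult.assoc[symmetric])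
    qed
    then have eq: "(r + s) * (2 ^ n * ?w x) = 2 ^ n * (r * a x + s * b x)"
      by (metis mult.left_commute)
    have "(u + v) x - (r + s) * (2 ^ n * ?w x) = (u x - r * (2 ^ n * a x)) + (v x - s * (2 ^ n * b x))"
      unfolding eq by (simp add: algebra_simps)
    then show "\<bar>(u + v) x - (r + s) * (2 ^ n * ?w x)\<bar> \<le> (r + s) / 2 ^ n"
      using abs_triangle_ineq[of "u x - r * (2 ^ n * a x)" "v x - s * (2 ^ n * b x)"]
        ab(5)[of x] ab(6)[of x] by (simp only: add_divide_distrib)
  qed (use ab in simp)
  then show "layer_gauge n (u + v) \<le> layer_gauge n u + layer_gauge n v + e"
    using gauge_le by (fastforce simp: r_def s_def)
qed

lemma gauge_scale_le:
  assumes "v \<in> bounded_funs"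
  shows "layer_gauge n (c *\<^sub>R v) \<le> \<bar>c\<bar> * layer_gauge n v"
proof (cases "c = 0")
  case True
  then show ?thesis using gauge_sup[of 0 "0 *\<^sub>R v" n] by (simp add: scaleR_fun_def)
next
  case False
  show ?thesis
  proof (rule gauge_leI)
    show "c *\<^sub>R v \<in> bounded_funs" using assms bounded_funs_scale by blast
    fix s assume s: "\<bar>c\<bar> * layer_gauge n v < s"
    then have "layer_gauge n v < s / \<bar>c\<bar>" using False by (simp add: field_simps)
    then have "s / \<bar>c\<bar> \<in> scales n v" using scales_gt assms by blast
    then obtain w where w: "0 < s / \<bar>c\<bar>" "w \<in> W"
      "\<And>x. \<bar>v x - s / \<bar>c\<bar> * (2 ^ n * w x)\<bar> \<le> s / \<bar>c\<bar> / 2 ^ n" by (metis scalesE)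
    show "s \<in> scales n (c *\<^sub>R v)"
    proof (rule scalesI)
      show "0 < s" using w False by (simp add: zero_less_divide_iff)
      show "sgn c *\<^sub>R w \<in> W" using w W_uminus False by (auto simp: sgn_if)
      fix x
      have "(c *\<^sub>R v) x - s * (2 ^ n * (sgn c *\<^sub>R w) x) = c * (v x - s / \<bar>c\<bar> * (2 ^ n * w x))"
        using False by (auto simp: scaleR_fun_def sgn_if abs_if field_simps)
      then have "\<bar>(c *\<^sub>R v) x - s * (2 ^ n * (sgn c *\<^sub>R w) x)\<bar> = \<bar>c\<bar> * \<bar>v x - s / \<bar>c\<bar> * (2 ^ n * w x)\<bar>"
        by (simp add: abs_mult)
      also have "\<dots> \<le> \<bar>c\<bar> * (s / \<bar>c\<bar> / 2 ^ n)" using w(3) by (intro mult_left_mono) auto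
      also have "\<dots> = s / 2 ^ n" using False by simp
      finally show "\<bar>(c *\<^sub>R v) x - s * (2 ^ n * (sgn c *\<^sub>R w) x)\<bar> \<le> s / 2 ^ n" .
    qed
  qed
qed

lemma gauge_scale:
  assumes "v \<in> bounded_funs"
  shows "layer_gauge n (c *\<^sub>R v) = \<bar>c\<bar> * layer_gauge n v"
proof (cases "c = 0")
  case True
  then show ?thesis
    using gauge_scale_le[OF assms, of n c] gauge_nonneg[OF bounded_funs_scale[OF assms], of n c] by simp
next
  case False
  have "layer_gauge n v = layer_gauge n ((1 / c) *\<^sub>R (c *\<^sub>R v))" using False by simp
  also have "\<dots> \<le> \<bar>1 / c\<bar> * layer_gauge n (c *\<^sub>R v)"
    by (rule gauge_scale_le[OF bounded_funs_scale[OF assms]])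
  finally have "\<bar>c\<bar> * layer_gauge n v \<le> layer_gauge n (c *\<^sub>R v)" using False by (simp add: field_simps)
  then show ?thesis using gauge_scale_le[OF assms] by (simp add: antisym)
qed

text \<open>The factor \<open>2\<close> arises because at level \<open>0\<close> the unit set is
  \<open>W\<close> plus the unit ball, and \<open>W\<close> is itself bounded by
  \<open>1\<close>.\<close>

lemma sup_le_gauge:
  assumes "v \<in> bounded_funs"
  shows "\<bar>v x\<bar> \<le> 2 * layer_gauge 0 v"
proof (rule field_le_epsilon)
  fix e :: real assume "0 < e"
  then have "layer_gauge 0 v + e / 2 \<in> scales 0 v" using scales_gt assms by simp
  then obtain w where w: "0 < layer_gauge 0 v + e / 2" "w \<in> W"
    "\<bar>v x - (layer_gauge 0 v + e / 2) * (2 ^ 0 * w x)\<bar> \<le> (layer_gauge 0 v + e / 2) / 2 ^ 0"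
    by (metis scalesE)
  have "(layer_gauge 0 v + e / 2) * \<bar>w x\<bar> \<le> (layer_gauge 0 v + e / 2) * 1"
    using w W_bound by (intro mult_left_mono) auto
  then have "\<bar>(layer_gauge 0 v + e / 2) * w x\<bar> \<le> layer_gauge 0 v + e / 2" using w(1) by (simp add: abs_mult)
  then show "\<bar>v x\<bar> \<le> 2 * layer_gauge 0 v + e" using w(3) abs_triangle_ineq2[of "v x" "(layer_gauge 0 v + e / 2) * w x"] by simp
qed

section \<open>The \<open>c0\<close>-sum of the gauges\<close>

lemma V_bounded: "v \<in> V \<Longrightarrow> v \<in> bounded_funs"
  by (simp add: V_def)

lemma gauge_le_N: "v \<in> V \<Longrightarrow> layer_gauge n v \<le> N v"
  unfolding N_def
proof (rule cSUP_upper)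
  assume "v \<in> V"
  then have "(\<lambda>n. layer_gauge n v) \<longlonglongrightarrow> 0" by (simp add: V_def)
  then have "Bseq (\<lambda>n. layer_gauge n v)" by (rule convergent_imp_Bseq[OF convergentI])
  then show "bdd_above (range (\<lambda>n. layer_gauge n v))" by (rule Bseq_bdd_above)
qed simp

lemma N_leI: "(\<And>n. layer_gauge n v \<le> r) \<Longrightarrow> N v \<le> r"
  unfolding N_def by (rule cSUP_least) auto

lemma sup_le_N: "v \<in> V \<Longrightarrow> \<bar>v x\<bar> \<le> 2 * N v"
  using sup_le_gauge[OF V_bounded, of v x] gauge_le_N[of v 0] by simp

lemma V_add: "\<lbrakk>u \<in> V; v \<in> V\<rbrakk> \<Longrightarrow> u + v \<in> V"
proof -
  assume uv: "u \<in> V" "v \<in> V"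
  then have "(\<lambda>n. layer_gauge n u + layer_gauge n v) \<longlonglongrightarrow> 0 + 0" unfolding V_def by (intro tendsto_add) auto
  then have lim: "(\<lambda>n. layer_gauge n u + layer_gauge n v) \<longlonglongrightarrow> 0" by simp
  have b: "u + v \<in> bounded_funs" by (intro bounded_funs_add V_bounded uv)
  have "(\<lambda>n. layer_gauge n (u + v)) \<longlonglongrightarrow> 0"
  proof (rule tendsto_sandwich[OF _ _ tendsto_const lim])
    show "\<forall>\<^sub>F n in sequentially. 0 \<le> layer_gauge n (u + v)" by (intro always_eventually allI gauge_nonneg b)
    show "\<forall>\<^sub>F n in sequentially. layer_gauge n (u + v) \<le> layer_gauge n u + layer_gauge n v"
      by (intro always_eventually allI gauge_add V_bounded uv)
  qed
  then show ?thesis using b by (simp add: V_def)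
qed

lemma V_scale: "v \<in> V \<Longrightarrow> c *\<^sub>R v \<in> V"
  using tendsto_mult_right_zero[of "\<lambda>n. layer_gauge n v" sequentially "\<bar>c\<bar>"]
  by (simp add: V_def gauge_scale bounded_funs_scale)

lemma V_zero: "0 \<in> V"
proof -
  have b: "0 \<in> bounded_funs" by (rule bounded_funsI[of _ 0]) simp
  have "layer_gauge n 0 = 0" for n using gauge_sup[of 0 0 n] gauge_nonneg[OF b, of n] by simp
  then have "(\<lambda>n. layer_gauge n 0) \<longlonglongrightarrow> 0" by (simp only: tendsto_const)
  then show ?thesis using b unfolding V_def by blast
qed

text \<open>As \<open>f\<close> lies in \<open>W\<close>, the factor \<open>(1 / 2) ^ n\<close> is
  admissible at level \<open>n\<close> without any error, so the gauges decay geometrically.\<close>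

lemma V_gen:
  assumes "f \<in> F"
  shows "f \<in> V"
proof -
  have b: "f \<in> bounded_funs" by (rule bounded_funsI[of _ 1]) (use assms F_bound in simp)
  have "layer_gauge n f \<le> (1 / 2) ^ n" for n
    by (rule gauge_le, rule scalesI[OF _ W_gen(2)[OF assms]]) (auto simp: power_divide)
  moreover have lim: "(\<lambda>n. (1 / 2 :: real) ^ n) \<longlonglongrightarrow> 0" by (rule LIMSEQ_realpow_zero) auto
  ultimately have "(\<lambda>n. layer_gauge n f) \<longlonglongrightarrow> 0"
    using gauge_nonneg[OF b]
    by (intro tendsto_sandwich[OF _ _ tendsto_const lim] always_eventually allI)
  then show ?thesis using b by (simp add: V_def)
qed

lemma normed_V: "normed_space_on V N"
  unfolding normed_space_on_def
proof (intro conjI ballI allI)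
  show "subspace V" unfolding subspace_def using V_zero V_add V_scale by blast
  fix v assume v: "v \<in> V"
  show N0: "0 \<le> N v" using gauge_le_N[OF v, of 0] gauge_nonneg[OF V_bounded[OF v], of 0] by simp
  show "N v = 0 \<longleftrightarrow> v = 0"
  proof
    assume "N v = 0"
    then have "v x = 0" for x using sup_le_N[OF v, of x] by simp
    then show "v = 0" by (simp add: fun_eq_iff)
  next
    assume "v = 0"
    then have "N v \<le> 0" using gauge_sup[of 0 v] by (intro N_leI) simp
    then show "N v = 0" using N0 by simp
  qed
  show "N (v + w) \<le> N v + N w" if w: "w \<in> V" for w
    by (rule N_leI, rule order_trans[OF gauge_add])
      (use v w V_bounded gauge_le_N in \<open>auto intro: add_mono\<close>)
  fix c
  have le: "N (c *\<^sub>R u) \<le> \<bar>c\<bar> * N u" if "u \<in> V" for u and c :: real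
    by (rule N_leI) (use that V_bounded gauge_le_N in \<open>auto simp: gauge_scale intro: mult_left_mono\<close>)
  show "N (c *\<^sub>R v) = \<bar>c\<bar> * N v"
  proof (cases "c = 0")
    case True
    have "N (0 *\<^sub>R v) \<le> 0" using le[OF v, of 0] by simp
    moreover have "0 \<le> N (0 *\<^sub>R v)"
      using gauge_le_N[OF V_scale[OF v], of 0 0] gauge_nonneg[OF V_bounded[OF V_scale[OF v]], of 0 0] by simp
    ultimately show ?thesis using True by simp
  next
    case False
    have "N v \<le> \<bar>1 / c\<bar> * N (c *\<^sub>R v)" using le[OF V_scale[OF v, of c], of "1 / c"] False by simp
    then have "\<bar>c\<bar> * N v \<le> N (c *\<^sub>R v)" using False by (simp add: field_simps)
    then show ?thesis using le[OF v, of c] by simp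
  qed
qed

text \<open>\<open>N\<close> dominates the supremum norm, so a Cauchy sequence has a uniform limit.
  The Cauchy bound passes to the limit at each level with a constant independent of the level, hence
  the \<open>c0\<close> condition survives.\<close>

lemma banach_V: "banach_space_on V N"
proof -
  interpret M: Metric_space V "norm_dist V N" by (rule Metric_space_norm_dist[OF normed_V])
  have dist: "norm_dist V N u v = N (u - v)" if "u \<in> V" "v \<in> V" for u v
    using that by (simp add: norm_dist_def)
  have diffV: "u - v \<in> V" if "u \<in> V" "v \<in> V" for u v
    using V_add[OF that(1) V_scale[OF that(2), of "-1"]] by simp
  have "M.mcomplete"
    unfolding M.mcomplete_def
  proof (intro allI impI)
    fix \<sigma> assume "M.MCauchy \<sigma>"
    then have \<sigma>: "\<And>n. \<sigma> n \<in> V"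
      and *: "\<And>\<epsilon>. \<epsilon> > 0 \<Longrightarrow> \<exists>k. \<forall>i j. k \<le> i \<longrightarrow> k \<le> j \<longrightarrow> norm_dist V N (\<sigma> i) (\<sigma> j) < \<epsilon>"
      unfolding M.MCauchy_def by auto
    have cauchy: "\<exists>k. \<forall>i\<ge>k. \<forall>j\<ge>k. N (\<sigma> i - \<sigma> j) < \<epsilon>" if "\<epsilon> > 0" for \<epsilon>
      using *[OF that] by (simp add: dist \<sigma>)
    have pt: "\<bar>\<sigma> i x - \<sigma> j x\<bar> \<le> 2 * N (\<sigma> i - \<sigma> j)" for i j x
      using sup_le_N[OF diffV[OF \<sigma> \<sigma>], of i j x] by simp
    have "convergent (\<lambda>i. \<sigma> i x)" for x
    proof -
      have "Cauchy (\<lambda>i. \<sigma> i x)"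
      proof (rule metric_CauchyI)
        fix e :: real assume "0 < e"
        then obtain k where "\<forall>i\<ge>k. \<forall>j\<ge>k. N (\<sigma> i - \<sigma> j) < e / 2" using cauchy[of "e / 2"] by auto
        then have "N (\<sigma> i - \<sigma> j) < e / 2" if "i \<ge> k" "j \<ge> k" for i j using that by blast
        then have "dist (\<sigma> i x) (\<sigma> j x) < e" if "i \<ge> k" "j \<ge> k" for i j
          using pt[of i x j] that unfolding dist_real_def by (smt (verit) field_sum_of_halves)
        then show "\<exists>M. \<forall>m\<ge>M. \<forall>n\<ge>M. dist (\<sigma> m x) (\<sigma> n x) < e" by blast
      qed
      then show ?thesis by (simp add: Cauchy_convergent_iff)
    qed
    then obtain v where v: "\<And>x. (\<lambda>i. \<sigma> i x) \<longlonglongrightarrow> v x" unfolding convergent_def by metis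
    have unif: "\<exists>k. \<forall>i\<ge>k. \<forall>x. \<bar>\<sigma> i x - v x\<bar> \<le> \<epsilon>" if "\<epsilon> > 0" for \<epsilon>
    proof -
      obtain k where k: "\<forall>i\<ge>k. \<forall>j\<ge>k. N (\<sigma> i - \<sigma> j) < \<epsilon> / 2" using cauchy[of "\<epsilon> / 2"] \<open>\<epsilon> > 0\<close> by auto
      have "\<bar>\<sigma> i x - v x\<bar> \<le> \<epsilon>" if "i \<ge> k" for i x
      proof (rule LIMSEQ_le_const2)
        show "(\<lambda>j. \<bar>\<sigma> i x - \<sigma> j x\<bar>) \<longlonglongrightarrow> \<bar>\<sigma> i x - v x\<bar>" by (intro tendsto_intros v)
        show "\<exists>M. \<forall>j\<ge>M. \<bar>\<sigma> i x - \<sigma> j x\<bar> \<le> \<epsilon>"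
        proof (intro exI[of _ k] allI impI)
          fix j assume "j \<ge> k"
          then have "N (\<sigma> i - \<sigma> j) < \<epsilon> / 2" using k that by blast
          then show "\<bar>\<sigma> i x - \<sigma> j x\<bar> \<le> \<epsilon>" using pt[of i x j] by simp
        qed
      qed
      then show ?thesis by blast
    qed
    have diffb: "\<sigma> i - v \<in> bounded_funs" for i
    proof -
      obtain k where k: "\<And>x. \<bar>\<sigma> k x - v x\<bar> \<le> 1" using unif[of 1] by auto
      have "\<sigma> k - v \<in> bounded_funs" by (rule bounded_funsI[of _ 1]) (use k in simp)
      then have "(\<sigma> i - \<sigma> k) + (\<sigma> k - v) \<in> bounded_funs"
        using bounded_funs_add V_bounded[OF diffV[OF \<sigma> \<sigma>]] by blast
      then show ?thesis by simp
    qed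
    have vb: "v \<in> bounded_funs" using bounded_funs_diff[OF V_bounded[OF \<sigma>[of 0]] diffb[of 0]] by simp
    have layer_gauge: "\<exists>k. \<forall>i\<ge>k. \<forall>n. layer_gauge n (\<sigma> i - v) \<le> \<epsilon>" if "\<epsilon> > 0" for \<epsilon>
    proof -
      obtain k where k: "\<forall>i\<ge>k. \<forall>j\<ge>k. N (\<sigma> i - \<sigma> j) < \<epsilon>" using cauchy[OF \<open>\<epsilon> > 0\<close>] by blast
      have "layer_gauge n (\<sigma> i - v) \<le> \<epsilon>" if i: "i \<ge> k" for i n
      proof (rule field_le_epsilon)
        fix e :: real assume e: "0 < e"
        then obtain l where l: "\<forall>j\<ge>l. \<forall>x. \<bar>\<sigma> j x - v x\<bar> \<le> e / 2 ^ n" using unif[of "e / 2 ^ n"] by auto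
        \<comment> \<open>This index may depend on \<open>n\<close> and \<open>e\<close>, since it
          disappears from the final bound.\<close>
        let ?j = "max k l"
        have "layer_gauge n (\<sigma> i - v) = layer_gauge n ((\<sigma> i - \<sigma> ?j) + (\<sigma> ?j - v))" by simp
        also have "\<dots> \<le> layer_gauge n (\<sigma> i - \<sigma> ?j) + layer_gauge n (\<sigma> ?j - v)"
          by (rule gauge_add[OF V_bounded[OF diffV[OF \<sigma> \<sigma>]] diffb])
        also have "layer_gauge n (\<sigma> i - \<sigma> ?j) \<le> \<epsilon>"
        proof -
          have "N (\<sigma> i - \<sigma> ?j) < \<epsilon>" using k i by simp
          then show ?thesis using gauge_le_N[OF diffV[OF \<sigma> \<sigma>], of n i ?j] by simp
        qed
        also have "layer_gauge n (\<sigma> ?j - v) \<le> 2 ^ n * (e / 2 ^ n)"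
          using l e by (intro gauge_sup) auto
        finally show "layer_gauge n (\<sigma> i - v) \<le> \<epsilon> + e" by simp
      qed
      then show ?thesis by blast
    qed
    have "v \<in> V"
    proof -
      have "(\<lambda>n. layer_gauge n v) \<longlonglongrightarrow> 0"
      proof (rule LIMSEQ_I)
        fix r :: real assume r: "0 < r"
        then obtain i where i: "\<And>n. layer_gauge n (\<sigma> i - v) \<le> r / 2" using layer_gauge[of "r / 2"] by auto
        have "(\<lambda>n. layer_gauge n (\<sigma> i)) \<longlonglongrightarrow> 0" using \<sigma> by (simp add: V_def)
        then obtain n0 where n0: "\<And>n. n \<ge> n0 \<Longrightarrow> \<bar>layer_gauge n (\<sigma> i)\<bar> < r / 2"
          using LIMSEQ_D[of "\<lambda>n. layer_gauge n (\<sigma> i)" 0 "r / 2"] r by auto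
        have "norm (layer_gauge n v - 0) < r" if "n \<ge> n0" for n
        proof -
          have "layer_gauge n v = layer_gauge n (\<sigma> i + (-1) *\<^sub>R (\<sigma> i - v))" by simp
          also have "\<dots> \<le> layer_gauge n (\<sigma> i) + layer_gauge n ((-1) *\<^sub>R (\<sigma> i - v))"
            by (rule gauge_add[OF V_bounded[OF \<sigma>] bounded_funs_scale[OF diffb]])
          also have "layer_gauge n ((-1) *\<^sub>R (\<sigma> i - v)) = layer_gauge n (\<sigma> i - v)"
            using gauge_scale[OF diffb, of n "-1" i] by simp
          finally show ?thesis using n0[OF that] i[of n] gauge_nonneg[OF vb, of n] by simp
        qed
        then show "\<exists>n0. \<forall>n\<ge>n0. norm (layer_gauge n v - 0) < r" by blast
      qed
      then show ?thesis using vb by (simp add: V_def)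
    qed
    moreover have "\<exists>k. \<forall>i\<ge>k. \<sigma> i \<in> V \<and> norm_dist V N (\<sigma> i) v < \<epsilon>" if "\<epsilon> > 0" for \<epsilon>
    proof -
      obtain k where "\<forall>i\<ge>k. \<forall>n. layer_gauge n (\<sigma> i - v) \<le> \<epsilon> / 2" using layer_gauge[of "\<epsilon> / 2"] \<open>\<epsilon> > 0\<close> by auto
      then have le: "N (\<sigma> i - v) \<le> \<epsilon> / 2" if "i \<ge> k" for i using that by (intro N_leI) blast
      have "norm_dist V N (\<sigma> i) v < \<epsilon>" if "i \<ge> k" for i
        unfolding dist[OF \<sigma> \<open>v \<in> V\<close>] using le[OF that] \<open>\<epsilon> > 0\<close> by linarith
      then show ?thesis using \<sigma> by blast
    qed
    ultimately show "\<exists>v. limitin M.mtopology \<sigma> v sequentially"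
      unfolding M.limit_metric_sequentially by blast
  qed
  then show ?thesis using normed_V by (simp add: banach_space_on_def)
qed

text \<open>Signed averages of a bounded sequence in \<open>V\<close> become small in the supremum norm, hence in each
  single gauge.  A gliding hump in the \<open>c\<^sub>0\<close>-sum then produces vectors of \<open>\<ell>\<^sub>1\<close>-norm \<open>j\<close> whose
  images have norm at most \<open>C + j * \<eta>\<close>, with \<open>\<eta>\<close> smaller than the lower embedding constant.\<close>

lemma rosenthal_V:
  assumes small: "rademacher_small F"
  shows "rosenthal_space_on V N"
  unfolding rosenthal_space_on_def
proof (intro conjI banach_V notI)
  assume "\<exists>T. isomorphic_embedding ell1 ell1_norm V N T"
  then obtain T c C where TV: "\<And>a. a \<in> ell1 \<Longrightarrow> T a \<in> V" and lin: "linear_map_on ell1 T"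
    and c: "0 < c" "\<And>a. a \<in> ell1 \<Longrightarrow> c * ell1_norm a \<le> N (T a)"
    and C: "\<And>a. a \<in> ell1 \<Longrightarrow> N (T a) \<le> C * ell1_norm a"
    unfolding isomorphic_embedding_def by fastforce
  have Wsmall: "rademacher_small W" unfolding W_def using small by (rule rademacher_small_hull)
  have unit: "unit_seq i \<in> ell1" "ell1_norm (unit_seq i) = 1" for i
    using comb_ell1[of "{i}" "\<lambda>_. 1"] by simp_all
  have C0: "0 < C" using c(1) c(2)[OF unit(1), of 0] C[OF unit(1), of 0] unit(2) by simp
  have tiny: "\<exists>I b. finite I \<and> I \<subseteq> {L..} \<and> (\<Sum>i\<in>I. \<bar>b i\<bar>) = 1 \<and> (\<forall>x. \<bar>T (comb I b) x\<bar> \<le> \<delta>)"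
    if "\<delta> > 0" for \<delta> :: real and L :: nat
  proof -
    \<comment> \<open>Strictly above the norms of the images of unit vectors, hence an admissible
      scale for them at every level.\<close>
    define D where "D = C + 1"
    have D: "0 < D" using C0 by (simp add: D_def)
    have "(\<lambda>n. D / 2 ^ n) \<longlonglongrightarrow> 0" by real_asymp
    then have "\<forall>\<^sub>F n in sequentially. D / 2 ^ n < \<delta> / 2"
      by (rule order_tendstoD) (use \<open>\<delta> > 0\<close> in simp)
    then obtain M where M: "D / 2 ^ M < \<delta> / 2"
      unfolding eventually_sequentially by blast
    \<comment> \<open>The ball part of the approximation at level \<open>M\<close> costs at most
      half of \<open>\<delta>\<close>; this value makes the part in \<open>W\<close>, enlarged by
      \<open>D * 2 ^ M\<close>, cost the other half.\<close>
    define \<gamma> where "\<gamma> = \<delta> / (2 * D * 2 ^ M)"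
    have "\<gamma> > 0" using D \<open>\<delta> > 0\<close> by (simp add: \<gamma>_def)
    from rademacher_small_signs[OF Wsmall this]
    obtain k where k: "k > 0" "\<forall>w. (\<forall>i<k. w i \<in> W) \<longrightarrow>
      (\<exists>e\<in>sign_vectors k. \<forall>x. \<bar>\<Sum>i<k. e i * w i x\<bar> \<le> \<gamma> * real k)" by blast
    let ?v = "\<lambda>i. T (unit_seq (L + i))"
    have "D \<in> scales M (?v i)" for i
    proof (rule scales_gt[OF V_bounded[OF TV[OF unit(1)]]])
      show "layer_gauge M (?v i) < D"
        using gauge_le_N[OF TV[OF unit(1)], of M "L + i"] C[OF unit(1), of "L + i"] unit(2)
        by (simp add: D_def)
    qed
    then have "\<forall>i. \<exists>w. w \<in> W \<and> (\<forall>x. \<bar>?v i x - D * (2 ^ M * w x)\<bar> \<le> D / 2 ^ M)"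
      by (meson scalesE)
    then obtain w where w: "\<And>i. w i \<in> W" "\<And>i x. \<bar>?v i x - D * (2 ^ M * w i x)\<bar> \<le> D / 2 ^ M"
      by metis
    obtain e where e: "e \<in> sign_vectors k" "\<And>x. \<bar>\<Sum>i<k. e i * w i x\<bar> \<le> \<gamma> * real k"
      using k(2)[rule_format, of w] w(1) by blast
    have e1: "\<bar>e i\<bar> = 1" if "i < k" for i using e(1) that by (auto dest!: PiE_mem[of _ _ _ i])
    define I where "I = (\<lambda>i. L + i) ` {..<k}"
    \<comment> \<open>Signs averaged over the block; the shift is needed because \<open>e\<close> is
      indexed from \<open>0\<close> and the block starts at \<open>L\<close>.\<close>
    define b where "b i = e (i - L) / real k" for i
    have sumI: "(\<Sum>i\<in>I. g i) = (\<Sum>i<k. g (L + i))" for g :: "nat \<Rightarrow> real"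
      unfolding I_def by (simp add: sum.reindex)
    have "(\<Sum>i\<in>I. \<bar>b i\<bar>) = 1" unfolding sumI using k(1) by (simp add: b_def e1)
    moreover have "\<bar>T (comb I b) x\<bar> \<le> \<delta>" for x
    proof -
      have "T (comb I b) x = (\<Sum>i\<in>I. b i * T (unit_seq i) x)"
        unfolding linear_comb[OF lin, of I b, unfolded I_def, OF finite_imageI[OF finite_lessThan], folded I_def]
        by (rule sum_scaleR_fun_apply)
      also have "\<dots> = (\<Sum>i<k. e i * ?v i x) / real k"
        unfolding sumI by (simp add: b_def sum_divide_distrib)
      also have "(\<Sum>i<k. e i * ?v i x)
          = D * 2 ^ M * (\<Sum>i<k. e i * w i x) + (\<Sum>i<k. e i * (?v i x - D * (2 ^ M * w i x)))"
        by (simp add: sum_distrib_left sum.distrib[symmetric] algebra_simps)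
      finally have eq: "T (comb I b) x = \<dots> / real k" .
      have "\<bar>D * 2 ^ M * (\<Sum>i<k. e i * w i x)\<bar> \<le> D * 2 ^ M * (\<gamma> * real k)"
        using D e(2)[of x] by (simp add: abs_mult)
      also have "\<dots> = \<delta> / 2 * real k" using D by (simp add: \<gamma>_def)
      finally have 1: "\<bar>D * 2 ^ M * (\<Sum>i<k. e i * w i x)\<bar> \<le> \<delta> / 2 * real k" .
      have "\<bar>\<Sum>i<k. e i * (?v i x - D * (2 ^ M * w i x))\<bar>
          \<le> (\<Sum>i<k. \<bar>e i * (?v i x - D * (2 ^ M * w i x))\<bar>)" by (rule sum_abs)
      also have "\<dots> \<le> (\<Sum>i<k. D / 2 ^ M)"
        by (rule sum_mono) (use w(2) e1 in \<open>simp add: abs_mult\<close>)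
      also have "\<dots> \<le> \<delta> / 2 * real k" using mult_left_mono[of "D / 2 ^ M" "\<delta> / 2" "real k"] M by (simp add: mult.commute)
      finally have "\<bar>D * 2 ^ M * (\<Sum>i<k. e i * w i x) + (\<Sum>i<k. e i * (?v i x - D * (2 ^ M * w i x)))\<bar>
          \<le> \<delta> * real k" using 1 by linarith
      then show ?thesis unfolding eq using k(1) by (simp add: divide_le_eq)
    qed
    ultimately show ?thesis by (intro exI[of _ I] exI[of _ b]) (auto simp: I_def)
  qed
  \<comment> \<open>The constructed norms grow by at most \<open>c / 2\<close> per block, while the
    embedding demands growth \<open>c\<close>.\<close>
  define \<eta> where "\<eta> = c / 2"
  have \<eta>: "\<eta> > 0" using c by (simp add: \<eta>_def)
  have "\<exists>I b. finite I \<and> (\<Sum>i\<in>I. \<bar>b i\<bar>) = real j \<and> N (T (comb I b)) \<le> C + real j * \<eta>" for j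
  proof (induction j)
    case 0
    have "N (T (comb {} (\<lambda>_. 0))) \<le> C * 0"
      using C[OF comb_ell1(1)[OF finite.emptyI]] comb_ell1(2)[OF finite.emptyI] by fastforce
    then show ?case using C0 by (intro exI[of _ "{}"] exI[of _ "\<lambda>_. 0"]) auto
  next
    case (Suc j)
    then obtain I b where I: "finite I" "(\<Sum>i\<in>I. \<bar>b i\<bar>) = real j"
      and N: "N (T (comb I b)) \<le> C + real j * \<eta>" by blast
    let ?s = "T (comb I b)"
    have s: "?s \<in> V" using TV comb_ell1(1) I by blast
    then have "(\<lambda>n. layer_gauge n ?s) \<longlonglongrightarrow> 0" by (simp add: V_def)
    then obtain n0 where n0: "\<And>n. n \<ge> n0 \<Longrightarrow> layer_gauge n ?s < \<eta>"
      using order_tendstoD(2)[of _ 0 sequentially \<eta>] \<eta> unfolding eventually_sequentially by blast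
    have "0 < \<eta> / 2 ^ n0" using \<eta> by simp
    from tiny[OF this, of "Suc (Max (insert 0 I))"] obtain J d where J: "finite J" "J \<subseteq> {Suc (Max (insert 0 I))..}" "(\<Sum>i\<in>J. \<bar>d i\<bar>) = 1"
      and d: "\<And>x. \<bar>T (comb J d) x\<bar> \<le> \<eta> / 2 ^ n0" by blast
    let ?y = "T (comb J d)"
    have y: "?y \<in> V" using TV comb_ell1(1) J by blast
    have disj: "I \<inter> J = {}"
    proof -
      have "i \<le> Max (insert 0 I)" if "i \<in> I" for i using I that by simp
      then have "I \<subseteq> {..Max (insert 0 I)}" by blast
      then show ?thesis using J(2) by force
    qed
    define b' where "b' i = (if i \<in> I then b i else d i)" for i
    have comb: "comb (I \<union> J) b' = comb I b + comb J d"
      using disj by (auto simp: comb_def b'_def fun_eq_iff)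
    have "(\<Sum>i\<in>I \<union> J. \<bar>b' i\<bar>) = (\<Sum>i\<in>I. \<bar>b' i\<bar>) + (\<Sum>i\<in>J. \<bar>b' i\<bar>)"
      using I J disj by (intro sum.union_disjoint) auto
    also have "(\<Sum>i\<in>I. \<bar>b' i\<bar>) = real j" using I(2) by (simp add: b'_def)
    also have "(\<Sum>i\<in>J. \<bar>b' i\<bar>) = (\<Sum>i\<in>J. \<bar>d i\<bar>)"
      by (rule sum.cong) (use disj in \<open>auto simp: b'_def\<close>)
    finally have sum: "(\<Sum>i\<in>I \<union> J. \<bar>b' i\<bar>) = real (Suc j)" using J(3) by simp
    have T: "T (comb (I \<union> J) b') = ?s + ?y"
      unfolding comb using lin comb_ell1(1)[OF I(1)] comb_ell1(1)[OF J(1)]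
      unfolding linear_map_on_def by blast
    \<comment> \<open>From level \<open>n0\<close> on the old vector has gauge below
      \<open>\<eta>\<close> and the new block at most \<open>C\<close>. Below \<open>n0\<close> the
      tiny supremum norm of the block keeps its gauge under \<open>\<eta>\<close>, and the induction
      hypothesis controls the old vector.\<close>
    have "N (?s + ?y) \<le> C + real (Suc j) * \<eta>"
    proof (rule N_leI)
      fix n
      have add: "layer_gauge n (?s + ?y) \<le> layer_gauge n ?s + layer_gauge n ?y" using s y V_bounded gauge_add by blast
      show "layer_gauge n (?s + ?y) \<le> C + real (Suc j) * \<eta>"
      proof (cases "n \<ge> n0")
        case True
        have "layer_gauge n ?y \<le> C"
          using gauge_le_N[OF y, of n] C[OF comb_ell1(1)[OF J(1)], of d] comb_ell1(2)[OF J(1), of d] J(3)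
          by simp
        then have "layer_gauge n (?s + ?y) \<le> C + \<eta>" using add n0[OF True] by simp
        moreover have "0 \<le> real j * \<eta>" using \<eta> by simp
        moreover have "real (Suc j) * \<eta> = real j * \<eta> + \<eta>" by (simp add: algebra_simps)
        ultimately show ?thesis by linarith
      next
        case False
        have "layer_gauge n ?y \<le> 2 ^ n * (\<eta> / 2 ^ n0)" using \<eta> d by (intro gauge_sup) auto
        also have "\<dots> \<le> 2 ^ n0 * (\<eta> / 2 ^ n0)"
          using False \<eta> by (intro mult_right_mono power_increasing) auto
        finally have "layer_gauge n ?y \<le> \<eta>" by simp
        then show ?thesis using add gauge_le_N[OF s, of n] N by (simp add: algebra_simps)
      qed
    qed
    then have "N (T (comb (I \<union> J) b')) \<le> C + real (Suc j) * \<eta>" unfolding T .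
    then show ?case using sum I(1) J(1) by blast
  qed
  then have le: "c * real j \<le> C + real j * \<eta>" for j
    using c(2)[OF comb_ell1(1)] comb_ell1(2) by (metis order_trans)
  obtain j :: nat where "C / \<eta> < real j" using reals_Archimedean2 by blast
  then have "C < real j * \<eta>" using \<eta> by (simp add: field_simps)
  moreover have "c * real j = 2 * (real j * \<eta>)" by (simp add: \<eta>_def)
  ultimately show False using le[of j] by linarith
qed

end

section \<open>Representations on interpolation spaces\<close>

text \<open>The group acts on the interpolation space by translation, and points of \<open>K\<close>
  act by evaluation. Vectors are functions on the whole type, so they are made to vanish off
  \<open>topspace K\<close>; otherwise the unit of \<open>G\<close> would not act as the
  identity.\<close>

theorem rosenthal_representable_if_rademacher_small:
  fixes K :: "'k topology" and act :: "'g \<Rightarrow> 'k \<Rightarrow> 'k"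
    and G (structure) and F :: "('k \<Rightarrow> real) set"
  assumes "group G" and compact: "compact_space K"
    and act_closed: "\<And>g x. \<lbrakk>g \<in> carrier G; x \<in> topspace K\<rbrakk> \<Longrightarrow> act g x \<in> topspace K"
    and act_one: "\<And>x. x \<in> topspace K \<Longrightarrow> act \<one> x = x"
    and act_mult: "\<And>g h x. \<lbrakk>g \<in> carrier G; h \<in> carrier G; x \<in> topspace K\<rbrakk> \<Longrightarrow>
      act (g \<otimes> h) x = act g (act h x)"
    and F_bound: "\<And>f x. f \<in> F \<Longrightarrow> \<bar>f x\<bar> \<le> 1"
    and F_off: "\<And>f x. \<lbrakk>f \<in> F; x \<notin> topspace K\<rbrakk> \<Longrightarrow> f x = 0"
    and F_cont: "\<And>f. f \<in> F \<Longrightarrow> continuous_map K euclideanreal f"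
    and F_sep: "\<And>x y. \<lbrakk>x \<in> topspace K; y \<in> topspace K; x \<noteq> y\<rbrakk> \<Longrightarrow> \<exists>f\<in>F. f x \<noteq> f y"
    and F_inv: "\<And>f g. \<lbrakk>f \<in> F; g \<in> carrier G\<rbrakk> \<Longrightarrow>
      (\<lambda>x. if x \<in> topspace K then f (act g x) else 0) \<in> F"
    and small: "rademacher_small F"
  shows "rosenthal_representable G (discrete_topology (carrier G)) K act"
proof -
  interpret G: group G by fact
  interpret interpolation F by unfold_locales (rule F_bound)
  define U where "U g v = (\<lambda>x. if x \<in> topspace K then v (act (inv g) x) else 0)"
    for g and v :: "'k \<Rightarrow> real"
  have U_lin: "U g (a + b) = U g a + U g b" "U g (c *\<^sub>R a) = c *\<^sub>R U g a" for g a b c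
    by (auto simp: U_def scaleR_fun_def fun_eq_iff)
  have U_W: "U g w \<in> W" if g: "g \<in> carrier G" and w: "w \<in> W" for g w
  proof -
    have "W \<subseteq> {w. U g w \<in> W}"
    proof (rule W_induct)
      show "convex {w. U g w \<in> W}"
      proof (rule convexI)
        fix a b u v assume "a \<in> {w. U g w \<in> W}" "b \<in> {w. U g w \<in> W}" "0 \<le> u" "0 \<le> v" "u + v = (1::real)"
        then have "u *\<^sub>R U g a + v *\<^sub>R U g b \<in> W" using convex_W by (intro convexD) simp_all
        then show "u *\<^sub>R a + v *\<^sub>R b \<in> {w. U g w \<in> W}" by (simp only: U_lin mem_Collect_eq)
      qed
      have "U g 0 = 0" by (simp add: U_def fun_eq_iff)
      then show "0 \<in> {w. U g w \<in> W}" using W_gen(1) by simp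
      fix f assume f: "f \<in> F"
      have Uf: "U g f \<in> W" unfolding U_def by (rule W_gen(2)[OF F_inv[OF f]]) (use g in simp)
      have "U g (- f) = - U g f" by (simp add: U_def fun_eq_iff)
      then show "f \<in> {w. U g w \<in> W}" "- f \<in> {w. U g w \<in> W}" using Uf W_uminus[OF Uf] by simp_all
    qed
    then show ?thesis using w by blast
  qed
  have U_bounded: "U g v \<in> bounded_funs" if v: "v \<in> bounded_funs" for g v
  proof -
    obtain B where B: "0 < B" "\<And>x. \<bar>v x\<bar> \<le> B" using bounded_funsE[OF v] by blast
    show ?thesis by (rule bounded_funsI[of _ B]) (use B in \<open>simp add: U_def\<close>)
  qed
  have U_gauge: "layer_gauge n (U g v) \<le> layer_gauge n v" if g: "g \<in> carrier G" and v: "v \<in> bounded_funs" for g v n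
  proof (rule gauge_leI[OF U_bounded[OF v]])
    fix s assume "layer_gauge n v < s"
    then have "s \<in> scales n v" by (rule scales_gt[OF v])
    then obtain w where w: "0 < s" "w \<in> W" "\<And>x. \<bar>v x - s * (2 ^ n * w x)\<bar> \<le> s / 2 ^ n"
      unfolding scales_def by blast
    show "s \<in> scales n (U g v)"
      by (rule scalesI[OF w(1) U_W[OF g w(2)]]) (use w(1,3) in \<open>simp add: U_def\<close>)
  qed
  have U_V: "U g v \<in> V" and U_N: "N (U g v) \<le> N v" if g: "g \<in> carrier G" and v: "v \<in> V" for g v
  proof -
    have b: "v \<in> bounded_funs" "U g v \<in> bounded_funs" using V_bounded[OF v] U_bounded by simp_all
    have lim: "(\<lambda>n. layer_gauge n v) \<longlonglongrightarrow> 0" using v by (simp add: V_def)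
    have "(\<lambda>n. layer_gauge n (U g v)) \<longlonglongrightarrow> 0"
      using gauge_nonneg[OF b(2)] U_gauge[OF g b(1)]
      by (intro tendsto_sandwich[OF _ _ tendsto_const lim] always_eventually allI)
    then show "U g v \<in> V" using b(2) by (simp add: V_def)
    show "N (U g v) \<le> N v"
      using order_trans[OF U_gauge[OF g b(1)] gauge_le_N[OF v]] by (rule N_leI)
  qed
  have W_cont: "W \<subseteq> {w. continuous_map K euclideanreal w}"
  proof (rule W_induct)
    show "convex {w. continuous_map K euclideanreal w}"
      by (rule convexI)
        (simp add: plus_fun_def scaleR_fun_def continuous_map_add continuous_map_real_mult_left)
    show "0 \<in> {w. continuous_map K euclideanreal w}"
      unfolding zero_fun_def by simp
    fix f assume f: "f \<in> F"
    show "f \<in> {w. continuous_map K euclideanreal w}" "- f \<in> {w. continuous_map K euclideanreal w}"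
      unfolding fun_Compl_def using F_cont[OF f] by (simp_all add: continuous_map_minus)
  qed
  have W_off: "W \<subseteq> {w. \<forall>x. x \<notin> topspace K \<longrightarrow> w x = 0}"
  proof (rule W_induct)
    show "convex {w. \<forall>x. x \<notin> topspace K \<longrightarrow> w x = (0::real)}"
      by (rule convexI) (simp add: scaleR_fun_def)
  qed (use F_off in simp_all)
  \<comment> \<open>\<open>N v + 1\<close> is an admissible scale at all levels while the balls
    shrink, so \<open>v\<close> is a uniform limit of multiples of elements of \<open>W\<close>.
    Continuity and vanishing off \<open>topspace K\<close> thereby pass from \<open>W\<close> to
    \<open>V\<close>.\<close>
  have V_approx: "\<exists>w\<in>W. \<exists>c. \<forall>x. \<bar>v x - c * w x\<bar> \<le> \<epsilon>" if v: "v \<in> V" and \<epsilon>: "\<epsilon> > 0" for v \<epsilon>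
  proof -
    have "(\<lambda>n. c / 2 ^ n) \<longlonglongrightarrow> 0" for c :: real by real_asymp
    then have "\<forall>\<^sub>F n in sequentially. (N v + 1) / 2 ^ n < \<epsilon>"
      by (rule order_tendstoD) (rule \<epsilon>)
    then obtain n where n: "(N v + 1) / 2 ^ n < \<epsilon>" unfolding eventually_sequentially by blast
    have "N v + 1 \<in> scales n v"
      by (rule scales_gt[OF V_bounded[OF v]]) (use gauge_le_N[OF v, of n] in simp)
    then obtain w where w: "w \<in> W" "\<And>x. \<bar>v x - (N v + 1) * (2 ^ n * w x)\<bar> \<le> (N v + 1) / 2 ^ n"
      unfolding scales_def by blast
    have "\<bar>v x - ((N v + 1) * 2 ^ n) * w x\<bar> \<le> \<epsilon>" for x
      using w(2)[of x] n by (simp add: mult.assoc)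
    then show ?thesis using w(1) by blast
  qed
  have V_off: "v x = 0" if v: "v \<in> V" and x: "x \<notin> topspace K" for v x
  proof -
    have "\<bar>v x\<bar> \<le> 0 + \<epsilon>" if "\<epsilon> > 0" for \<epsilon>
    proof -
      obtain w c where w: "w \<in> W" "\<bar>v x - c * w x\<bar> \<le> \<epsilon>" using V_approx[OF v \<open>\<epsilon> > 0\<close>] by blast
      have "w x = 0" using W_off w(1) x by blast
      then show ?thesis using w(2) by simp
    qed
    then have "\<bar>v x\<bar> \<le> 0" by (rule field_le_epsilon)
    then show ?thesis by simp
  qed
  have V_cont: "continuous_map K euclideanreal v" if v: "v \<in> V" for v
  proof -
    have "\<forall>n. \<exists>w c. w \<in> W \<and> (\<forall>x. \<bar>v x - c * w x\<bar> \<le> 1 / real (Suc n))"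
      using V_approx[OF v] by (meson of_nat_0_less_iff zero_less_Suc zero_less_divide_1_iff)
    then obtain w c where w: "\<And>n. w n \<in> W" "\<And>n x. \<bar>v x - c n * w n x\<bar> \<le> 1 / real (Suc n)"
      by metis
    have "continuous_map K Met_TC.mtopology v"
    proof (rule Met_TC.continuous_map_uniform_limit_alt)
      have "continuous_map K euclideanreal (\<lambda>x. c n * w n x)" for n
        using W_cont w(1) by (intro continuous_map_real_mult_left) blast
      then show "\<forall>\<^sub>F n in sequentially. continuous_map K Met_TC.mtopology (\<lambda>x. c n * w n x)"
        by simp
      fix \<epsilon> :: real assume "0 < \<epsilon>"
      then have "\<forall>\<^sub>F n in sequentially. inverse (real (Suc n)) < \<epsilon>"
        using order_tendstoD(2)[OF LIMSEQ_inverse_real_of_nat] by blast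
      then show "\<forall>\<^sub>F n in sequentially. \<forall>x\<in>topspace K. dist (c n * w n x) (v x) < \<epsilon>"
      proof (rule eventually_mono)
        fix n assume "inverse (real (Suc n)) < \<epsilon>"
        then show "\<forall>x\<in>topspace K. dist (c n * w n x) (v x) < \<epsilon>"
          using w(2)[of _ n] unfolding dist_real_def inverse_eq_divide
          by (metis abs_minus_commute le_less_trans)
      qed
    qed auto
    then show ?thesis by simp
  qed
  have U_mult: "U (g \<otimes> h) v = U g (U h v)" if "g \<in> carrier G" "h \<in> carrier G" for g h v
    using that act_closed act_mult by (simp add: U_def fun_eq_iff G.inv_mult_group)
  have U_one: "U \<one> v = v" if "v \<in> V" for v
    using that act_one V_off by (auto simp: U_def fun_eq_iff)
  have U_inv: "U (inv g) (U g v) = v" "U g (U (inv g) v) = v" if "g \<in> carrier G" "v \<in> V" for g v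
    using that U_mult[symmetric] U_one by simp_all
  have U_N_eq: "N (U g v) = N v" if "g \<in> carrier G" "v \<in> V" for g v
    using U_N[OF that] U_N[OF _ U_V[OF that], of "inv g"] U_inv(1)[OF that] that by simp
  define h where "h g = restrict (U g) V" for g
  let ?I = "iso_group V N"
  have h_Bij: "h g \<in> Bij V" if g: "g \<in> carrier G" for g
  proof -
    have "bij_betw (h g) V V"
      by (rule bij_betw_byWitness[of _ "U (inv g)"])
        (use g U_inv U_V in \<open>auto simp: h_def\<close>)
    then show ?thesis by (simp add: Bij_def h_def)
  qed
  have h_iso: "h g \<in> carrier ?I" if g: "g \<in> carrier G" for g
    using h_Bij[OF g] U_N_eq[OF g] V_add V_scale U_lin
    by (simp add: iso_group_def linear_map_on_def h_def)
  have I_mult: "S \<otimes>\<^bsub>?I\<^esub> T = compose V S T" if "S \<in> carrier ?I" "T \<in> carrier ?I" for S T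
    using that by (simp add: iso_group_def BijGroup_def)
  have I_one: "\<one>\<^bsub>?I\<^esub> = (\<lambda>v\<in>V. v)" by (simp add: iso_group_def BijGroup_def)
  have h_mult: "h (g \<otimes> k) = h g \<otimes>\<^bsub>?I\<^esub> h k" if "g \<in> carrier G" "k \<in> carrier G" for g k
    unfolding I_mult[OF h_iso[OF that(1)] h_iso[OF that(2)]]
    using that U_V U_mult by (auto simp: h_def compose_def fun_eq_iff)
  have h_one: "h \<one> = \<one>\<^bsub>?I\<^esub>"
    unfolding I_one h_def using U_one by (auto simp: fun_eq_iff)
  have h_inv: "inv\<^bsub>?I\<^esub> (h g) = h (inv g)" if g: "g \<in> carrier G" for g
    unfolding m_inv_def[of ?I]
  proof (rule the_equality)
    show *: "h (inv g) \<in> carrier ?I \<and> h g \<otimes>\<^bsub>?I\<^esub> h (inv g) = \<one>\<^bsub>?I\<^esub> \<and> h (inv g) \<otimes>\<^bsub>?I\<^esub> h g = \<one>\<^bsub>?I\<^esub>"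
      using g h_iso h_mult[symmetric] h_one by simp
    fix T assume T: "T \<in> carrier ?I \<and> h g \<otimes>\<^bsub>?I\<^esub> T = \<one>\<^bsub>?I\<^esub> \<and> T \<otimes>\<^bsub>?I\<^esub> h g = \<one>\<^bsub>?I\<^esub>"
    \<comment> \<open>Uniqueness of inverses is taken from \<open>BijGroup V\<close>, whose product
      and unit \<open>iso_group\<close> inherits.\<close>
    have sub: "S \<in> carrier (BijGroup V)" if "S \<in> carrier ?I" for S
      using that by (simp add: iso_group_def BijGroup_def)
    have mult: "S \<otimes>\<^bsub>BijGroup V\<^esub> T = S \<otimes>\<^bsub>?I\<^esub> T" "\<one>\<^bsub>BijGroup V\<^esub> = \<one>\<^bsub>?I\<^esub>" for S T
      by (simp_all add: iso_group_def)
    interpret B: group "BijGroup V" by (rule group_BijGroup)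
    show "T = h (inv g)"
      by (rule B.inv_unique[of _ "h g"]) (use T * h_iso[OF g] sub mult in simp_all)
  qed
  have h_hom: "h \<in> hom G ?I" unfolding hom_def using h_iso h_mult by simp
  interpret M: Metric_space V "norm_dist V N" by (rule Metric_space_norm_dist[OF normed_V])
  have h_cont: "continuous_map (discrete_topology (carrier G)) (strong_operator_topology V N) h"
  proof -
    have "h g \<in> topspace (strong_operator_topology V N)" if g: "g \<in> carrier G" for g
      using h_iso[OF g] h_Bij[OF g] Bij_imp_funcset[OF h_Bij[OF g]]
      by (simp add: strong_operator_topology_def norm_topology_def PiE_def Bij_def)
    then show ?thesis by simp
  qed
  \<comment> \<open>Halving compensates the factor \<open>2\<close> in \<open>sup_le_N\<close> and
    puts the evaluations into the unit ball.\<close>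
  define \<alpha> where "\<alpha> x = (\<lambda>v\<in>V. v x / 2)" for x
  have \<alpha>_ball: "\<alpha> x \<in> dual_ball V N" for x
  proof -
    have le: "\<bar>\<alpha> x v\<bar> \<le> 1 * N v" if "v \<in> V" for v
      using sup_le_N[OF that, of x] that by (simp add: \<alpha>_def)
    have "linear_map_on V (\<alpha> x)"
      unfolding linear_map_on_def using V_add V_scale
      by (auto simp: \<alpha>_def scaleR_fun_def add_divide_distrib)
    moreover have "\<alpha> x \<in> extensional V" by (simp add: \<alpha>_def)
    ultimately have "\<alpha> x \<in> dual_space V N" unfolding dual_space_def using le by blast
    moreover have "dual_norm V N (\<alpha> x) \<le> 1"
      unfolding dual_norm_def
    proof (rule cSUP_least)
      have "N 0 = 0" using normed_V V_zero unfolding normed_space_on_def by blast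
      then show "{v \<in> V. N v \<le> 1} \<noteq> {}" using V_zero by force
      show "\<bar>\<alpha> x v\<bar> \<le> 1" if "v \<in> {v \<in> V. N v \<le> 1}" for v using le[of v] that by simp
    qed
    ultimately show ?thesis by (simp add: dual_ball_def)
  qed
  have emb: "embedding_map K (weak_star_ball V N) \<alpha>"
  proof (rule continuous_imp_embedding_map[OF _ compact])
    show "continuous_map K (weak_star_ball V N) \<alpha>"
      unfolding weak_star_ball_def continuous_map_in_subtopology continuous_map_componentwise
    proof (intro conjI ballI)
      show "\<alpha> ` topspace K \<subseteq> extensional V" by (auto simp: \<alpha>_def)
      show "\<alpha> \<in> topspace K \<rightarrow> dual_ball V N" using \<alpha>_ball by blast
      fix v assume v: "v \<in> V"
      have "continuous_map K euclideanreal (\<lambda>x. v x / 2)"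
        using continuous_map_real_mult_left[OF V_cont[OF v], of "1 / 2"] by simp
      then show "continuous_map K euclideanreal (\<lambda>x. \<alpha> x v)" using v by (simp add: \<alpha>_def)
    qed
    show "Hausdorff_space (weak_star_ball V N)"
      unfolding weak_star_ball_def
      by (rule Hausdorff_space_subtopology) (simp add: Hausdorff_space_product_topology)
    show "inj_on \<alpha> (topspace K)"
    proof (rule inj_onI, rule ccontr)
      fix x y assume xy: "x \<in> topspace K" "y \<in> topspace K" "\<alpha> x = \<alpha> y" "x \<noteq> y"
      then obtain f where f: "f \<in> F" "f x \<noteq> f y" using F_sep by blast
      have "\<alpha> x f = \<alpha> y f" using xy by simp
      then show False using f V_gen[OF f(1)] by (simp add: \<alpha>_def)
    qed
  qed
  have equiv: "\<alpha> (act g x) = dual_action V N h g (\<alpha> x)"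
    if g: "g \<in> carrier G" and x: "x \<in> topspace K" for g x
    unfolding dual_action_def h_inv[OF g] using g x U_V
    by (auto simp: \<alpha>_def h_def U_def fun_eq_iff)
  have "rosenthal_representation G (discrete_topology (carrier G)) K act V N h \<alpha>"
    unfolding rosenthal_representation_def
    using rosenthal_V[OF small] h_hom h_cont emb equiv by blast
  then show ?thesis unfolding rosenthal_representable_def by blast
qed

section \<open>The Roller compactification\<close>

text \<open>Set to \<open>0\<close> off the compactification because the representing vectors are
  functions on the whole type.\<close>

definition hs_eval :: "'a set \<Rightarrow> ('a \<Rightarrow> 'a \<Rightarrow> 'a \<Rightarrow> 'a) \<Rightarrow> 'a set \<Rightarrow> ('a set \<Rightarrow> bool) \<Rightarrow> real"
  where "hs_eval X m H \<xi> = of_bool (\<xi> \<in> topspace (roller X m) \<and> \<xi> H)"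

lemma topspace_roller:
  "topspace (roller X m) = halfspace_cube X m closure_of (roller_map X m ` X)"
  unfolding roller_def topspace_subtopology by (rule Int_absorb1[OF closure_of_subset_topspace])

lemma compact_space_roller: "compact_space (roller X m)"
proof -
  have "compact_space (halfspace_cube X m)"
    by (simp add: halfspace_cube_def compact_space_product_topology compact_space_discrete_topology)
  then have "compactin (halfspace_cube X m) (halfspace_cube X m closure_of (roller_map X m ` X))"
    by (rule closedin_compact_space) simp
  then show ?thesis unfolding roller_def by (rule compact_space_subtopology)
qed

lemma roller_extensional: "\<xi> \<in> topspace (roller X m) \<Longrightarrow> \<xi> \<in> extensional (halfspaces X m)"
  unfolding roller_def halfspace_cube_def by (auto simp: PiE_def)

lemma continuous_map_coordinate:
  "H \<in> halfspaces X m \<Longrightarrow> continuous_map (halfspace_cube X m) (discrete_topology UNIV) (\<lambda>\<xi>. \<xi> H)"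
  unfolding halfspace_cube_def by (rule continuous_map_product_projection)

text \<open>Fixing finitely many coordinates is an open condition, and the image of \<open>X\<close>
  is dense.\<close>

lemma roller_finite_approx:
  assumes \<xi>: "\<xi> \<in> topspace (roller X m)" and H: "\<And>i. i < k \<Longrightarrow> H i \<in> halfspaces X m"
  shows "\<exists>x\<in>X. \<forall>i<k::nat. \<xi> (H i) \<longleftrightarrow> x \<in> H i"
proof -
  let ?O = "\<lambda>j. {\<eta> \<in> topspace (halfspace_cube X m). \<forall>i<j. \<eta> (H i) = \<xi> (H i)}"
  have "openin (halfspace_cube X m) (?O j)" if "j \<le> k" for j
    using that
  proof (induction j)
    case (Suc j)
    have "openin (halfspace_cube X m) {\<eta> \<in> topspace (halfspace_cube X m). \<eta> (H j) \<in> {\<xi> (H j)}}"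
      by (rule openin_continuous_map_preimage[OF continuous_map_coordinate]) (use Suc H in auto)
    then have "openin (halfspace_cube X m)
        (?O j \<inter> {\<eta> \<in> topspace (halfspace_cube X m). \<eta> (H j) \<in> {\<xi> (H j)}})"
      using Suc by (intro openin_Int) auto
    also have "?O j \<inter> {\<eta> \<in> topspace (halfspace_cube X m). \<eta> (H j) \<in> {\<xi> (H j)}} = ?O (Suc j)"
      by (auto simp: less_Suc_eq)
    finally show ?case .
  qed simp
  then have "openin (halfspace_cube X m) (?O k)" by simp
  moreover have "\<xi> \<in> ?O k"
    using \<xi> unfolding topspace_roller in_closure_of by simp
  moreover have "\<exists>\<eta>. \<eta> \<in> roller_map X m ` X \<and> \<eta> \<in> T"
    if "openin (halfspace_cube X m) T" "\<xi> \<in> T" for T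
    using \<xi> that unfolding topspace_roller in_closure_of by blast
  ultimately have "\<exists>\<eta>. \<eta> \<in> roller_map X m ` X \<and> \<eta> \<in> ?O k" by presburger
  then obtain x where x: "x \<in> X" "roller_map X m x \<in> ?O k" by (elim exE conjE imageE) simp
  have "\<xi> (H i) \<longleftrightarrow> x \<in> H i" if "i < k" for i
  proof -
    have "roller_map X m x (H i) = \<xi> (H i)" using x(2) that by blast
    then show ?thesis using H[OF that] by (simp add: roller_map_def)
  qed
  then show ?thesis using x(1) by (intro bexI[of _ x]) simp_all
qed

text \<open>Only patterns realised by points of \<open>X\<close> occur on the compactification, so
  Sauer-Shelah applies to the index sets of halfspaces containing a point. \<open>Suc d\<close>
  instead of \<open>d\<close> pays for the zero pattern of arguments outside the
  compactification.\<close>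

lemma card_roller_patterns:
  assumes not_shattered: "\<forall>(k::nat) H. (\<forall>i<k. H i \<in> halfspaces X m) \<and>
      (\<forall>S\<subseteq>{..<k}. \<exists>x\<in>X. \<forall>i<k. x \<in> H i \<longleftrightarrow> i \<in> S) \<longrightarrow> k \<le> d"
    and f: "\<And>i. i < k \<Longrightarrow> f i \<in> hs_eval X m ` halfspaces X m"
  shows "card ((\<lambda>\<xi>. \<lambda>i\<in>{..<k}. f i \<xi>) ` UNIV) \<le> (k + 1) ^ Suc d"
proof -
  have "\<forall>i. \<exists>H. i < k \<longrightarrow> H \<in> halfspaces X m \<and> f i = hs_eval X m H" using f by blast
  then obtain H where H: "\<And>i. i < k \<Longrightarrow> H i \<in> halfspaces X m"
    "\<And>i. i < k \<Longrightarrow> f i = hs_eval X m (H i)" by metis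
  define A where "A = (\<lambda>x. {i. i < k \<and> x \<in> H i}) ` X"
  have sub: "A \<subseteq> Pow {..<k}" by (auto simp: A_def)
  have "card A \<le> (k + 1) ^ d"
  proof (rule sauer_shelah[OF sub])
    fix T assume T: "T \<subseteq> {..<k}" "shatters A T"
    then have "finite T" using finite_subset by blast
    then obtain g where g: "bij_betw g {..<card T} T"
      using ex_bij_betw_nat_finite atLeast0LessThan by metis
    have gk: "g i \<in> T" "g i < k" if "i < card T" for i
      using bij_betw_apply[OF g, of i] that T(1) by auto
    show "card T \<le> d"
    proof (rule not_shattered[THEN spec, of "card T", THEN spec, of "\<lambda>i. H (g i)", THEN mp], rule conjI)
      show "\<forall>i<card T. H (g i) \<in> halfspaces X m" using gk H by blast
      show "\<forall>S\<subseteq>{..<card T}. \<exists>x\<in>X. \<forall>i<card T. x \<in> H (g i) \<longleftrightarrow> i \<in> S"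
      proof (intro allI impI)
        fix S assume S: "S \<subseteq> {..<card T}"
        then have "g ` S \<subseteq> T" using gk by auto
        then obtain x where x: "x \<in> X" "{i. i < k \<and> x \<in> H i} \<inter> T = g ` S"
          using T(2) unfolding shatters_def A_def by blast
        have "x \<in> H (g i) \<longleftrightarrow> i \<in> S" if i: "i < card T" for i
        proof -
          have "x \<in> H (g i) \<longleftrightarrow> g i \<in> g ` S" using x(2) gk[OF i] by blast
          also have "\<dots> \<longleftrightarrow> i \<in> S"
            using inj_on_image_mem_iff[OF bij_betw_imp_inj_on[OF g], of i S] S i by simp
          finally show ?thesis .
        qed
        then show "\<exists>x\<in>X. \<forall>i<card T. x \<in> H (g i) \<longleftrightarrow> i \<in> S" using x(1) by blast
      qed
    qed
  qed
  let ?P = "\<lambda>Y. \<lambda>i\<in>{..<k}. of_bool (i \<in> Y) :: real"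
  have fin: "finite A" using sub by (rule finite_subset) simp
  have "(\<lambda>\<xi>. \<lambda>i\<in>{..<k}. f i \<xi>) ` UNIV \<subseteq> ?P ` insert {} A"
  proof (rule image_subsetI)
    fix \<xi>
    show "(\<lambda>i\<in>{..<k}. f i \<xi>) \<in> ?P ` insert {} A"
    proof (cases "\<xi> \<in> topspace (roller X m)")
      case True
      then obtain x where x: "x \<in> X" "\<forall>i<k. \<xi> (H i) \<longleftrightarrow> x \<in> H i"
        using roller_finite_approx[of \<xi> X m k H] H(1) by blast
      have "(\<lambda>i\<in>{..<k}. f i \<xi>) = ?P {i. i < k \<and> x \<in> H i}"
        using x True H(2) by (intro restrict_ext) (simp add: hs_eval_def)
      then show ?thesis using x(1) unfolding A_def by blast
    next
      case False
      then have "(\<lambda>i\<in>{..<k}. f i \<xi>) = ?P {}"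
        using H(2) by (intro restrict_ext) (simp add: hs_eval_def)
      then show ?thesis by blast
    qed
  qed
  then have "card ((\<lambda>\<xi>. \<lambda>i\<in>{..<k}. f i \<xi>) ` UNIV) \<le> card (?P ` insert {} A)"
    using fin by (intro card_mono) simp_all
  also have "\<dots> \<le> (k + 1) ^ Suc d"
  proof (cases "k = 0")
    \<comment> \<open>Here the extra factor \<open>k + 1\<close> gains nothing, but there is just
      one pattern.\<close>
    case True
    then have "?P ` insert {} A \<subseteq> {\<lambda>_. undefined}" by (auto simp: restrict_def)
    then have "card (?P ` insert {} A) \<le> card {\<lambda>_::nat. undefined :: real}" by (intro card_mono) auto
    then show ?thesis using True by simp
  next
    case False
    have "card (?P ` insert {} A) \<le> card (insert {} A)" using fin by (intro card_image_le) simp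
    also have "\<dots> \<le> card A + 1" using card_insert_le_m1[of "card A + 1" A "{}"] by simp
    also have "\<dots> \<le> (k + 1) ^ d + (k + 1) ^ d" using \<open>card A \<le> (k + 1) ^ d\<close> by (intro add_mono) simp_all
    also have "\<dots> \<le> (k + 1) ^ Suc d" using False by simp
    finally show ?thesis .
  qed
  finally show ?thesis .
qed

section \<open>Automorphisms permute halfspaces and act on the compactification\<close>

lemma automorphism_image_convex:
  assumes m: "median_algebra X m" and g: "median_automorphism X m g" and C: "median_convex X m C"
  shows "median_convex X m (g ` C)"
proof -
  interpret median_algebra X m by fact
  have bij: "bij_betw g X X"
    and hom: "\<And>x y z. \<lbrakk>x \<in> X; y \<in> X; z \<in> X\<rbrakk> \<Longrightarrow> g (m x y z) = m (g x) (g y) (g z)"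
    using g by (simp_all add: median_automorphism_def median_hom_def)
  have CX: "C \<subseteq> X" using C by (simp add: median_convex_def)
  have im: "g ` X = X" by (rule bij_betw_imp_surj_on[OF bij])
  show ?thesis
    unfolding median_convex_def
  proof (intro conjI ballI subsetI)
    show "x \<in> X" if "x \<in> g ` C" for x using that CX im by blast
    fix x y z assume "x \<in> g ` C" "y \<in> g ` C" and z: "z \<in> median_interval X m x y"
    then obtain a b where ab: "a \<in> C" "b \<in> C" "x = g a" "y = g b" by blast
    have "z \<in> X" using z by (simp add: median_interval_def)
    then obtain c where c: "c \<in> X" "z = g c" using im by blast
    have abX: "a \<in> X" "b \<in> X" using ab CX by blast+
    have "g (m a b c) = g c" using z ab c abX by (simp add: hom median_interval_def)
    then have "m a b c = c"
      using inj_onD[OF bij_betw_imp_inj_on[OF bij]] c abX closed by blast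
    then have "c \<in> C"
      using C ab c unfolding median_convex_def median_interval_def by blast
    then show "z \<in> g ` C" using c by blast
  qed
qed

lemma automorphism_image_halfspace:
  assumes m: "median_algebra X m" and g: "median_automorphism X m g" and H: "H \<in> halfspaces X m"
  shows "g ` H \<in> halfspaces X m"
proof -
  have bij: "bij_betw g X X" using g by (simp add: median_automorphism_def)
  have HX: "H \<subseteq> X" using H by (simp add: halfspaces_def median_convex_def)
  have "X - g ` H = g ` (X - H)"
    using inj_on_image_set_diff[OF bij_betw_imp_inj_on[OF bij], of X H] HX
      bij_betw_imp_surj_on[OF bij] by simp
  then show ?thesis
    using H automorphism_image_convex[OF m g] unfolding halfspaces_def mem_Collect_eq
    by (simp only: image_is_empty) blast
qed

theorem corollary5p4:
  fixes X :: "'a set"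
    and m :: "'a \<Rightarrow> 'a \<Rightarrow> 'a \<Rightarrow> 'a"
    and G :: "('g, 'r) monoid_scheme"
    and act :: "'g \<Rightarrow> 'a \<Rightarrow> 'a"
  assumes "median_algebra X m"
    and "median_rank X m < \<infinity>"
    and "group_action G X act"
    and "\<And>g. g \<in> carrier G \<Longrightarrow> median_automorphism X m (act g)"
  shows "rosenthal_representable G (discrete_topology (carrier G))
    (roller X m) (roller_action G X m act)"
proof -
  interpret A: group_action G X act by fact
  interpret G: group G using A.group_hom by (simp add: group_hom_def)
  let ?HS = "halfspaces X m" and ?K = "topspace (roller X m)" and ?\<rho> = "roller_action G X m act"
  have HX: "H \<subseteq> X" if "H \<in> ?HS" for H using that by (simp add: halfspaces_def median_convex_def)
  have image: "act g ` H \<in> ?HS" if "g \<in> carrier G" "H \<in> ?HS" for g H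
    by (rule automorphism_image_halfspace[OF assms(1) assms(4)[OF that(1)] that(2)])
  have image_one: "act \<one>\<^bsub>G\<^esub> ` H = H" if "H \<in> ?HS" for H
  proof -
    have "act \<one>\<^bsub>G\<^esub> x = x" if "x \<in> H" for x
      using A.id_eq_one HX[OF \<open>H \<in> ?HS\<close>] that by (metis restrict_apply' subsetD)
    then show ?thesis by simp
  qed
  have image_mult: "act (g \<otimes>\<^bsub>G\<^esub> h) ` H = act g ` act h ` H"
    if "g \<in> carrier G" "h \<in> carrier G" "H \<in> ?HS" for g h H
    using A.composition_rule[OF _ that(1,2)] HX[OF that(3)] unfolding image_image
    by (intro image_cong) auto
  have \<rho>_ext: "?\<rho> g \<xi> \<in> extensional ?HS" for g \<xi> by (simp add: roller_action_def)
  \<comment> \<open>The map is continuous on the whole cube and sends the image of \<open>X\<close>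
    into itself, hence it preserves the closure.\<close>
  have \<rho>_closed: "?\<rho> g \<xi> \<in> ?K" if g: "g \<in> carrier G" and \<xi>: "\<xi> \<in> ?K" for g \<xi>
  proof -
    let ?C = "halfspace_cube X m" and ?R = "roller_map X m ` X"
    have "continuous_map ?C ?C (?\<rho> g)"
      unfolding halfspace_cube_def continuous_map_componentwise
    proof (intro conjI ballI)
      show "?\<rho> g ` topspace (product_topology (\<lambda>_. discrete_topology UNIV) ?HS) \<subseteq> extensional ?HS"
        using \<rho>_ext by blast
      fix H assume H: "H \<in> ?HS"
      then have "act (inv\<^bsub>G\<^esub> g) ` H \<in> ?HS" using image g by simp
      from continuous_map_coordinate[OF this]
      show "continuous_map (product_topology (\<lambda>_. discrete_topology UNIV) ?HS)
          (discrete_topology UNIV) (\<lambda>\<xi>. ?\<rho> g \<xi> H)"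
        using H by (simp add: roller_action_def halfspace_cube_def)
    qed
    from continuous_map_image_closure_subset[OF this, of ?R]
    have "?\<rho> g \<xi> \<in> ?C closure_of (?\<rho> g ` ?R)" using \<xi> unfolding topspace_roller by blast
    moreover have "?\<rho> g ` ?R \<subseteq> ?R"
    proof -
      have "?\<rho> g (roller_map X m x) = roller_map X m (act g x)" if x: "x \<in> X" for x
      proof
        fix H
        have "x \<in> act (inv\<^bsub>G\<^esub> g) ` H \<longleftrightarrow> act g x \<in> H" if H: "H \<in> ?HS"
        proof
          assume "x \<in> act (inv\<^bsub>G\<^esub> g) ` H"
          then have "act g x \<in> act g ` act (inv\<^bsub>G\<^esub> g) ` H" by blast
          then show "act g x \<in> H"
            using image_mult[OF g G.inv_closed[OF g] H] image_one[OF H] g by simp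
        next
          assume "act g x \<in> H"
          then have "act (inv\<^bsub>G\<^esub> g) (act g x) \<in> act (inv\<^bsub>G\<^esub> g) ` H" by blast
          then show "x \<in> act (inv\<^bsub>G\<^esub> g) ` H"
            using A.orbit_sym_aux[OF g x refl] by simp
        qed
        then show "?\<rho> g (roller_map X m x) H = roller_map X m (act g x) H"
          using image[OF G.inv_closed[OF g]] by (simp add: roller_action_def roller_map_def)
      qed
      then show ?thesis using A.element_image[OF g] by fastforce
    qed
    ultimately show ?thesis
      unfolding topspace_roller using closure_of_mono by blast
  qed
  obtain d where d: "\<forall>(k::nat) H. (\<forall>i<k. H i \<in> ?HS) \<and>
      (\<forall>S\<subseteq>{..<k}. \<exists>x\<in>X. \<forall>i<k. x \<in> H i \<longleftrightarrow> i \<in> S) \<longrightarrow> k \<le> d"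
    using finite_rank_not_shattered[OF assms(1,2)] by (rule exE)
  show ?thesis
  proof (rule rosenthal_representable_if_rademacher_small[where F = "hs_eval X m ` ?HS"])
    show "group G" by (rule G.is_group)
    show "compact_space (roller X m)" by (rule compact_space_roller)
    show "?\<rho> g \<xi> \<in> ?K" if "g \<in> carrier G" "\<xi> \<in> ?K" for g \<xi> using \<rho>_closed that .
    show "?\<rho> \<one>\<^bsub>G\<^esub> \<xi> = \<xi>" if "\<xi> \<in> ?K" for \<xi>
      by (rule extensionalityI[OF \<rho>_ext roller_extensional[OF that]])
        (simp add: roller_action_def image_one)
    show "?\<rho> (g \<otimes>\<^bsub>G\<^esub> h) \<xi> = ?\<rho> g (?\<rho> h \<xi>)"
      if "g \<in> carrier G" "h \<in> carrier G" "\<xi> \<in> ?K" for g h \<xi>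
      by (rule extensionalityI[OF \<rho>_ext \<rho>_ext])
        (use that image image_mult in \<open>simp add: roller_action_def G.inv_mult_group\<close>)
    show "\<bar>f \<xi>\<bar> \<le> 1" if "f \<in> hs_eval X m ` ?HS" for f \<xi>
      using that by (auto simp: hs_eval_def)
    show "f \<xi> = 0" if "f \<in> hs_eval X m ` ?HS" "\<xi> \<notin> ?K" for f \<xi>
      using that by (auto simp: hs_eval_def)
    show "continuous_map (roller X m) euclideanreal f" if f: "f \<in> hs_eval X m ` ?HS" for f
    proof -
      obtain H where H: "H \<in> ?HS" "f = hs_eval X m H" using f by blast
      have "continuous_map (roller X m) (discrete_topology UNIV) (\<lambda>\<xi>. \<xi> H)"
        unfolding roller_def by (rule continuous_map_from_subtopology[OF continuous_map_coordinate[OF H(1)]])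
      from continuous_map_compose[OF this, of euclideanreal of_bool]
      have "continuous_map (roller X m) euclideanreal (\<lambda>\<xi>. of_bool (\<xi> H))" by (simp add: o_def)
      then show ?thesis
        by (rule continuous_map_eq) (simp add: H(2) hs_eval_def)
    qed
    show "\<exists>f\<in>hs_eval X m ` ?HS. f \<xi> \<noteq> f \<eta>" if K: "\<xi> \<in> ?K" "\<eta> \<in> ?K" and "\<xi> \<noteq> \<eta>" for \<xi> \<eta>
    proof -
      obtain H where "H \<in> ?HS" "\<xi> H \<noteq> \<eta> H"
        using extensionalityI[OF roller_extensional[OF K(1)] roller_extensional[OF K(2)]] \<open>\<xi> \<noteq> \<eta>\<close>
        by blast
      then show ?thesis using K by (intro bexI[of _ "hs_eval X m H"]) (auto simp: hs_eval_def)
    qed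
    show "(\<lambda>\<xi>. if \<xi> \<in> ?K then f (?\<rho> g \<xi>) else 0) \<in> hs_eval X m ` ?HS"
      if f: "f \<in> hs_eval X m ` ?HS" and g: "g \<in> carrier G" for f g
    proof -
      obtain H where H: "H \<in> ?HS" "f = hs_eval X m H" using f by blast
      \<comment> \<open>Translating the coordinate of \<open>H\<close> by \<open>g\<close> gives the
        coordinate of the halfspace \<open>g^-1 H\<close>, so the family of coordinates is
        invariant.\<close>
      have "(\<lambda>\<xi>. if \<xi> \<in> ?K then f (?\<rho> g \<xi>) else 0) = hs_eval X m (act (inv\<^bsub>G\<^esub> g) ` H)"
      proof
        fix \<xi>
        show "(if \<xi> \<in> ?K then f (?\<rho> g \<xi>) else 0) = hs_eval X m (act (inv\<^bsub>G\<^esub> g) ` H) \<xi>"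
          using \<rho>_closed[OF g, of \<xi>] H by (simp add: hs_eval_def roller_action_def)
      qed
      then show ?thesis using image[OF G.inv_closed[OF g] H(1)] by simp
    qed
    show "rademacher_small (hs_eval X m ` ?HS)"
    proof (rule polynomial_growth_rademacher_small)
      show "f \<xi> \<in> {0, 1}" if "f \<in> hs_eval X m ` ?HS" for f \<xi>
        using that by (auto simp: hs_eval_def)
      show "card ((\<lambda>\<xi>. \<lambda>i\<in>{..<k}. f i \<xi>) ` UNIV) \<le> (k + 1) ^ Suc d"
        if "\<And>i. i < k \<Longrightarrow> f i \<in> hs_eval X m ` ?HS" for k f
        using d that by (rule card_roller_patterns)
    qed
  qed
qed

end
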